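(* Let $F=U/\Gamma$ be a compact Riemann surface of genus $g\ge2$, $d=3g-3$, let $r(t)\,dt^2$ be a holomorphic quadratic differential on $F$ and let $q_1(t)\,dt^2,\dots,q_d(t)\,dt^2$ be a basis of the space $Q(F)$ of holomorphic quadratic differentials on $F$. For $h=(h_1,\dots,h_d)\in\mathbf{C}^d$ with $|h|=\max_j|h_j|<\varepsilon$, $\varepsilon>0$ sufficiently small, let $z(t,h)$ be the solution on $U$ of the Schwarz equation $$\{z,t\}=2\Big[r(t)+\sum_{j=1}^d h_jq_j(t)\Big]$$ normalized by $z(t,h)=(t-t_0)+O((t-t_0)^3)$, $\sqrt{z'(t,h)}=1+O((t-t_0)^2)$ as $t\to t_0$. Then for every $L\in\Gamma$ the matrix of the element of the monodromy group of $z(t,h)$ corresponding to $L$ satisfies, for $|h|<\varepsilon$, $$\begin{pmatrix}\alpha_L(h)&\beta_L(h)\\ \gamma_L(h)&\delta_L(h)\end{pmatrix}=\Big[I+\sum_{|k|=1}A_{0;k}(Lt_0)h^k+\sum_{|k|=2}A_{1;k}(Lt_0)h^k+\dots+\sum_{|k|=n}A_{n-1;k}(Lt_0)h^k+\dots\Big]\begin{pmatrix}\alpha_L(0)&\beta_L(0)\\ \gamma_L(0)&\delta_L(0)\end{pmatrix},$$ where $I$ is the $2\times2$ identity matrix, $$A_{0;e_j}(t)=\int_{t_0}^tM_j(s)\,ds,\qquad M_j(s)=q_j(s)\begin{pmatrix}-u(s)v(s)&v(s)^2\\ -u(s)^2&u(s)v(s)\end{pmatrix},\quad j=1,\dots,d,$$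 and, for $n\ge1$ and multi-indices $k=(k_1,\dots,k_d)$ with $|k|=n+1$, $$A_{n;k}(t)=\int_{t_0}^t\sum_{\{j:\,k_j\ne0\}}A_{n-1;k-e_j}(s)M_j(s)\,ds.$$
   Context: $U=\{t\in\mathbf{C}:|t|<1\}$; $\Gamma$ is the Fuchsian group of covering transformations of the universal covering $U\to F$; $t_0\in U$ is a fixed point. Holomorphic quadratic differentials on $F$ are identified with holomorphic functions $q$ on $U$ with $q(Lt)L'(t)^2=q(t)$ for $L\in\Gamma$. The Schwarzian derivative is $\{z,t\}=(z''/z')'-\tfrac12(z''/z')^2$. Multi-index notation: $k=(k_1,\dots,k_d)$ has nonnegative integer entries, $|k|=k_1+\dots+k_d$, $h^k=h_1^{k_1}\cdots h_d^{k_d}$, and $e_j$ is the multi-index with $1$ in the $j$-th place and $0$ elsewhere. $u(t,h),v(t,h)$ denote the solutions on $U$ of $y''+[r(t)+\sum_{j=1}^dh_jq_j(t)]\,y=0$ with $u(t_0,h)=1$, $u'(t_0,h)=0$, $v(t_0,h)=0$, $v'(t_0,h)=1$; then $z(t,h)=v(t,h)/u(t,h)$. Write $u(s)=u(s,0)$, $v(s)=v(s,0)$. Integrals are along arbitrary paths in $U$ (integrands are holomorphic). Monodromy matrices: for each $L\in\Gamma$ fix the holomorphic branch $\xi_L(t)=\sqrt{L'(t)}$, chosen so that $\xi_{LK}(t)=\xi_L(Kt)\xi_K(t)$ for all $L,K\in\Gamma$ (the choice is independent of $h$). The matrix is determined by $$\begin{pmatrix}v(Lt,h)\\ u(Lt,h)\end{pmatrix}=\xi_L(t)\begin{pmatrix}\alpha_L(h)&\beta_L(h)\\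 \gamma_L(h)&\delta_L(h)\end{pmatrix}\begin{pmatrix}v(t,h)\\ u(t,h)\end{pmatrix},\qquad t\in U,$$ so that $z(Lt,h)=\dfrac{\alpha_L(h)z(t,h)+\beta_L(h)}{\gamma_L(h)z(t,h)+\delta_L(h)}$; the monodromy group of $z(t,h)$ consists of these linear fractional transformations as $L$ runs over $\Gamma$. *)

theory Defs
  imports
    "HOL-Complex_Analysis.Complex_Analysis"
    "HOL-Homology.Homology"
    "HOL-Algebra.Bij"
    "HOL-Algebra.Free_Abelian_Groups"
    "HOL-Library.Landau_Symbols"
begin

unbundle no fps_syntax

abbreviation unit_disc :: "complex set" where
  "unit_disc \<equiv> ball 0 1"


section \<open>Riemann surfaces and their uniformization by the disc\<close>

text \<open>A Riemann surface is a subspace \<open>F\<close> of some topological space together with an atlas of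
  charts \<open>(V, \<phi>)\<close>. Second countability is not listed, being automatic (and obvious if \<open>F\<close> is
  compact).\<close>

definition riemann_surface ::
  "'a::topological_space set \<Rightarrow> ('a set \<times> ('a \<Rightarrow> complex)) set \<Rightarrow> bool" where
  "riemann_surface F \<A> \<longleftrightarrow>
     F \<noteq> {} \<and> connected F \<and> Hausdorff_space (top_of_set F) \<and>
     (\<Union>(V, \<phi>)\<in>\<A>. V) = F \<and>
     (\<forall>(V, \<phi>)\<in>\<A>. openin (top_of_set F) V \<and> open (\<phi> ` V) \<and>
                 (\<exists>\<psi>. homeomorphism V (\<phi> ` V) \<phi> \<psi>)) \<and>
     (\<forall>(V, \<phi>)\<in>\<A>. \<forall>(W, \<psi>)\<in>\<A>. (\<psi> \<circ> inv_into V \<phi>) holomorphic_on \<phi> ` (V \<inter> W))"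

text \<open>The genus of a compact Riemann surface, topologically: \<open>H\<^sub>1(F; \<int>) \<cong> \<int>\<^sup>2\<^sup>g\<close>.\<close>

definition has_genus :: "'a::topological_space set \<Rightarrow> nat \<Rightarrow> bool" where
  "has_genus F g \<longleftrightarrow> homology_group 1 (top_of_set F) \<cong> free_Abelian_group {..<2 * g}"

definition disc_universal_covering ::
  "'a::topological_space set \<Rightarrow> ('a set \<times> ('a \<Rightarrow> complex)) set \<Rightarrow> (complex \<Rightarrow> 'a) \<Rightarrow> bool" where
  "disc_universal_covering F \<A> p \<longleftrightarrow>
     covering_space unit_disc p F \<and>
     (\<forall>(V, \<phi>)\<in>\<A>. (\<phi> \<circ> p) holomorphic_on (unit_disc \<inter> p -` V))"

text \<open>The elements are taken in \<^term>\<open>Bij unit_disc\<close>, i.e. they are normalized to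
  \<^term>\<open>undefined\<close> off the disc, so that equality of covering transformations is equality of
  functions; their product is \<^term>\<open>compose unit_disc\<close>.\<close>

definition covering_transformations :: "(complex \<Rightarrow> 'a) \<Rightarrow> (complex \<Rightarrow> complex) set" where
  "covering_transformations p =
     {L \<in> Bij unit_disc. L holomorphic_on unit_disc \<and> (\<forall>t\<in>unit_disc. p (L t) = p t)}"

text \<open>Holomorphic quadratic differentials on \<open>U/\<Gamma>\<close>, as functions on the disc \<open>U\<close>. Only the
  values on the disc matter here and below.\<close>

definition quadratic_differential ::
  "(complex \<Rightarrow> complex) set \<Rightarrow> (complex \<Rightarrow> complex) \<Rightarrow> bool" where
  "quadratic_differential \<Gamma> q \<longleftrightarrow>
     q holomorphic_on unit_disc \<and>
     (\<forall>L\<in>\<Gamma>. \<forall>t\<in>unit_disc. q (L t) * (deriv L t)\<^sup>2 = q t)"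

definition quadratic_differential_basis ::
  "(complex \<Rightarrow> complex) set \<Rightarrow> ('d::finite \<Rightarrow> complex \<Rightarrow> complex) \<Rightarrow> bool" where
  "quadratic_differential_basis \<Gamma> q \<longleftrightarrow>
     (\<forall>j. quadratic_differential \<Gamma> (q j)) \<and>
     (\<forall>c. (\<forall>t\<in>unit_disc. (\<Sum>j\<in>UNIV. c j * q j t) = 0) \<longrightarrow> (\<forall>j. c j = 0)) \<and>
     (\<forall>f. quadratic_differential \<Gamma> f \<longrightarrow> (\<exists>c. \<forall>t\<in>unit_disc. f t = (\<Sum>j\<in>UNIV. c j * q j t)))"

text \<open>A choice of branches \<open>\<xi>\<^sub>L = \<surd>L'\<close> that is multiplicative along the group.\<close>

definition sqrt_deriv_branches ::
  "(complex \<Rightarrow> complex) set \<Rightarrow> ((complex \<Rightarrow> complex) \<Rightarrow> complex \<Rightarrow> complex) \<Rightarrow> bool" where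
  "sqrt_deriv_branches \<Gamma> \<xi> \<longleftrightarrow>
     (\<forall>L\<in>\<Gamma>. \<xi> L holomorphic_on unit_disc \<and> (\<forall>t\<in>unit_disc. (\<xi> L t)\<^sup>2 = deriv L t)) \<and>
     (\<forall>L\<in>\<Gamma>. \<forall>K\<in>\<Gamma>. \<forall>t\<in>unit_disc. \<xi> (compose unit_disc L K) t = \<xi> L (K t) * \<xi> K t)"


section \<open>The Schwarz equation and the associated linear equation\<close>

definition schwarzian :: "(complex \<Rightarrow> complex) \<Rightarrow> complex \<Rightarrow> complex" where
  "schwarzian z t =
     deriv (\<lambda>s. deriv (deriv z) s / deriv z s) t - 1 / 2 * (deriv (deriv z) t / deriv z t)\<^sup>2"

text \<open>Solutions of \<open>{z, t} = 2R(t)\<close> on the disc are meromorphic; \<^const>\<open>nicely_meromorphic_on\<close>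
  only fixes the values at removable singularities and poles. The equation is required off the
  poles (it has a meaning only where \<open>z' \<noteq> 0\<close>), and at a pole it holds by continuation. As
  \<open>z' \<rightarrow> 1\<close> at \<open>t\<^sub>0\<close>, the branch of \<open>\<surd>z'\<close> tending to \<open>1\<close> is the principal one.\<close>

definition normalized_schwarz_solution ::
  "complex \<Rightarrow> (complex \<Rightarrow> complex) \<Rightarrow> (complex \<Rightarrow> complex) \<Rightarrow> bool" where
  "normalized_schwarz_solution t0 R z \<longleftrightarrow>
     z nicely_meromorphic_on unit_disc \<and>
     (\<forall>t\<in>unit_disc. \<not> is_pole z t \<longrightarrow> deriv z t \<noteq> 0 \<and> schwarzian z t = 2 * R t) \<and>
     (\<lambda>t. z t - (t - t0)) \<in> O[at t0](\<lambda>t. (t - t0) ^ 3) \<and>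
     (\<lambda>t. csqrt (deriv z t) - 1) \<in> O[at t0](\<lambda>t. (t - t0)\<^sup>2)"

definition linear_solution ::
  "complex \<Rightarrow> (complex \<Rightarrow> complex) \<Rightarrow> complex \<Rightarrow> complex \<Rightarrow> (complex \<Rightarrow> complex) \<Rightarrow> bool" where
  "linear_solution t0 R a b y \<longleftrightarrow>
     y holomorphic_on unit_disc \<and>
     (\<forall>t\<in>unit_disc. deriv (deriv y) t + R t * y t = 0) \<and>
     y t0 = a \<and> deriv y t0 = b"

definition perturbed ::
  "(complex \<Rightarrow> complex) \<Rightarrow> ('d::finite \<Rightarrow> complex \<Rightarrow> complex) \<Rightarrow> complex ^ 'd \<Rightarrow> complex \<Rightarrow> complex" where
  "perturbed r q h t = r t + (\<Sum>j\<in>UNIV. h $ j * q j t)"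

definition max_norm :: "complex ^ 'd::finite \<Rightarrow> real" where
  "max_norm h = Max (range (\<lambda>j. cmod (h $ j)))"

text \<open>The matrix with rows \<open>(\<alpha>\<^sub>L, \<beta>\<^sub>L)\<close> and \<open>(\<gamma>\<^sub>L, \<delta>\<^sub>L)\<close>. The argument \<open>\<xi>\<close> is the branch
  of \<open>\<surd>L'\<close>.\<close>

definition monodromy_matrix ::
  "(complex \<Rightarrow> complex) \<Rightarrow> (complex \<Rightarrow> complex) \<Rightarrow> (complex \<Rightarrow> complex) \<Rightarrow> (complex \<Rightarrow> complex)
    \<Rightarrow> complex ^ 2 ^ 2" where
  "monodromy_matrix \<xi> u v L =
     (THE M. \<forall>t\<in>unit_disc. vector [v (L t), u (L t)] = \<xi> t *s (M *v vector [v t, u t]))"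


section \<open>The iterated integrals\<close>

definition unit_index :: "'d \<Rightarrow> 'd \<Rightarrow> nat" where
  "unit_index j = (\<lambda>i. if i = j then 1 else 0)"

definition index_size :: "('d::finite \<Rightarrow> nat) \<Rightarrow> nat" where
  "index_size k = (\<Sum>j\<in>UNIV. k j)"

definition index_power :: "complex ^ 'd::finite \<Rightarrow> ('d \<Rightarrow> nat) \<Rightarrow> complex" where
  "index_power h k = (\<Prod>j\<in>UNIV. (h $ j) ^ k j)"

text \<open>Integration is along the segment; by the lemma \<open>disc_integral_path\<close> below every path in
  the disc gives the same value.\<close>

definition disc_integral :: "complex \<Rightarrow> complex \<Rightarrow> (complex \<Rightarrow> complex ^ 2 ^ 2) \<Rightarrow> complex ^ 2 ^ 2" where
  "disc_integral t0 t f = (\<chi> i j. contour_integral (linepath t0 t) (\<lambda>s. f s $ i $ j))"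

lemma disc_integral_path:
  fixes f :: "complex \<Rightarrow> complex ^ 2 ^ 2" and i j :: 2
  assumes "\<And>i j. (\<lambda>s. f s $ i $ j) holomorphic_on unit_disc"
    and "valid_path \<gamma>" "path_image \<gamma> \<subseteq> unit_disc"
  shows "((\<lambda>s. f s $ i $ j) has_contour_integral
            disc_integral (pathstart \<gamma>) (pathfinish \<gamma>) f $ i $ j) \<gamma>"
proof -
  obtain G where G: "\<And>x. x \<in> unit_disc \<Longrightarrow>
      (G has_field_derivative f x $ i $ j) (at x within unit_disc)"
    using holomorphic_convex_primitive'[OF convex_ball open_ball assms(1)[of i j]] by auto
  have ends: "pathstart \<gamma> \<in> unit_disc" "pathfinish \<gamma> \<in> unit_disc"
    using assms(3) pathstart_in_path_image pathfinish_in_path_image by blast+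
  have "closed_segment (pathstart \<gamma>) (pathfinish \<gamma>) \<subseteq> unit_disc"
    using ends by (intro closed_segment_subset) auto
  then have "((\<lambda>s. f s $ i $ j) has_contour_integral (G (pathfinish \<gamma>) - G (pathstart \<gamma>)))
      (linepath (pathstart \<gamma>) (pathfinish \<gamma>))"
    using contour_integral_primitive[OF G, of "linepath (pathstart \<gamma>) (pathfinish \<gamma>)"] by simp
  then have "disc_integral (pathstart \<gamma>) (pathfinish \<gamma>) f $ i $ j
      = G (pathfinish \<gamma>) - G (pathstart \<gamma>)"
    by (simp add: disc_integral_def contour_integral_unique)
  then show ?thesis
    using contour_integral_primitive[OF G assms(2,3)] by simp
qed

definition kernel_matrix ::
  "(complex \<Rightarrow> complex) \<Rightarrow> (complex \<Rightarrow> complex) \<Rightarrow> (complex \<Rightarrow> complex) \<Rightarrow> complex \<Rightarrow> complex ^ 2 ^ 2" where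
  "kernel_matrix u v q s =
     map_matrix ((*) (q s))
       (vector [vector [- (u s * v s), (v s)\<^sup>2],
                vector [- ((u s)\<^sup>2), u s * v s]])"

text \<open>\<open>A\<^sub>n\<^sub>;\<^sub>k(t)\<close>, meaningful for \<open>|k| = n + 1\<close>; for \<open>n = 0\<close> the sum has the single term
  \<open>\<integral>M\<^sub>j\<close> if \<open>k = e\<^sub>j\<close> (see the lemma \<open>iterated_unit\<close>). The functions \<open>u\<close> and
  \<open>v\<close> are the solutions at \<open>h = 0\<close>, and \<open>k(j := k j - 1)\<close> is \<open>k - e\<^sub>j\<close>.\<close>

primrec iterated ::
  "complex \<Rightarrow> (complex \<Rightarrow> complex) \<Rightarrow> (complex \<Rightarrow> complex) \<Rightarrow> ('d::finite \<Rightarrow> complex \<Rightarrow> complex)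
    \<Rightarrow> nat \<Rightarrow> ('d \<Rightarrow> nat) \<Rightarrow> complex \<Rightarrow> complex ^ 2 ^ 2" where
  "iterated t0 u v q 0 k t =
     (\<Sum>j | k = unit_index j. disc_integral t0 t (kernel_matrix u v (q j)))"
| "iterated t0 u v q (Suc n) k t =
     disc_integral t0 t (\<lambda>s. \<Sum>j | k j \<noteq> 0.
       iterated t0 u v q n (k(j := k j - 1)) s ** kernel_matrix u v (q j) s)"

lemma iterated_unit:
  "iterated t0 u v q 0 (unit_index j) t = disc_integral t0 t (kernel_matrix u v (q j))"
proof -
  have "{i. unit_index j = unit_index i} = {j}"
    by (auto simp: unit_index_def fun_eq_iff split: if_splits)
  then show ?thesis by simp
qed

text \<open>The homogeneous part \<open>\<Sum>\<^bsub>|k| = n+1\<^esub> A\<^sub>n\<^sub>;\<^sub>k(t) h\<^sup>k\<close> of degree \<open>n + 1\<close>.\<close>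

definition homogeneous_part ::
  "complex \<Rightarrow> (complex \<Rightarrow> complex) \<Rightarrow> (complex \<Rightarrow> complex) \<Rightarrow> ('d::finite \<Rightarrow> complex \<Rightarrow> complex)
    \<Rightarrow> complex ^ 'd \<Rightarrow> complex \<Rightarrow> nat \<Rightarrow> complex ^ 2 ^ 2" where
  "homogeneous_part t0 u v q h t n =
     (\<Sum>k | index_size k = n + 1. map_matrix ((*) (index_power h k)) (iterated t0 u v q n k t))"

end

theory Submission
  imports Defs
begin

no_notation fps_nth (infixl "$" 75)

text \<open>Let \<open>Y\<^sub>h\<close> be the matrix with rows \<open>(v, v')\<close> and \<open>(u, u')\<close> at the parameter \<open>h\<close>. Variation of
  constants gives \<open>N' = N \<Sum>h\<^sub>jM\<^sub>j\<close> and \<open>N(t\<^sub>0) = I\<close> for \<open>N = Y\<^sub>h Y\<^sub>0\<inverse>\<close>, and the iterated integrals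
  are the Picard series of this equation, which converges for every \<open>h\<close>. Since \<open>L\<close> is a Moebius
  transformation, \<open>1/\<xi>\<^sub>L\<close> is affine, and \<open>v(Lt)/\<xi>\<^sub>L(t)\<close>, \<open>u(Lt)/\<xi>\<^sub>L(t)\<close> solve the same linear equation
  as \<open>v\<close> and \<open>u\<close>; comparing values and derivatives at \<open>t\<^sub>0\<close> shows that the monodromy matrix is
  \<open>Y\<^sub>h(Lt\<^sub>0) C\<close> with \<open>C\<close> independent of \<open>h\<close>, hence \<open>N(Lt\<^sub>0)\<close> times the one at \<open>h = 0\<close>.\<close>

section \<open>The linear equation and variation of constants\<close>

lemma constant_on_convex:
  fixes f :: "complex \<Rightarrow> complex"
  assumes "convex S" "\<And>t. t \<in> S \<Longrightarrow> (f has_field_derivative 0) (at t)" "x \<in> S" "y \<in> S"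
  shows "f x = f y"
  using has_field_derivative_zero_constant[OF assms(1), of f] assms(2-)
  by (metis has_field_derivative_at_within)

lemma linear_solution_derivs:
  assumes "linear_solution t0 R a b y" "t \<in> unit_disc"
  shows "(y has_field_derivative deriv y t) (at t)"
    and "(deriv y has_field_derivative - (R t * y t)) (at t)"
proof -
  have hol: "y holomorphic_on unit_disc" and eq: "deriv (deriv y) t = - (R t * y t)"
    using assms by (auto simp: linear_solution_def add_eq_0_iff)
  show "(y has_field_derivative deriv y t) (at t)"
    using holomorphic_derivI[OF hol open_ball assms(2)] .
  show "(deriv y has_field_derivative - (R t * y t)) (at t)"
    using holomorphic_derivI[OF holomorphic_deriv[OF hol open_ball] open_ball assms(2)] eq by simp
qed

text \<open>The equation has no first-order term, so the Wronskian has derivative zero and keeps the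
  value given by the initial data.\<close>

lemma wronskian_eq:
  assumes y1: "linear_solution t0 R a1 b1 y1" and y2: "linear_solution t0 R a2 b2 y2"
    and t: "t0 \<in> unit_disc" "t \<in> unit_disc"
  shows "y1 t * deriv y2 t - deriv y1 t * y2 t = a1 * b2 - b1 * a2"
proof -
  have "y1 t * deriv y2 t - deriv y1 t * y2 t = y1 t0 * deriv y2 t0 - deriv y1 t0 * y2 t0"
  proof (rule constant_on_convex[of unit_disc "\<lambda>t. y1 t * deriv y2 t - deriv y1 t * y2 t"])
    fix s :: complex assume "s \<in> unit_disc"
    note D = linear_solution_derivs[OF y1 this] linear_solution_derivs[OF y2 this]
    show "((\<lambda>t. y1 t * deriv y2 t - deriv y1 t * y2 t) has_field_derivative 0) (at s)"
      by (rule derivative_eq_intros D refl)+ (simp add: algebra_simps)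
  qed (use t in auto)
  then show ?thesis
    using y1 y2 by (simp add: linear_solution_def)
qed

text \<open>Cramer's rule: the coefficients are the Wronskians of \<open>y\<close> with
  \<open>v\<close> and of \<open>u\<close> with \<open>y\<close>, constants by
  \<open>wronskian_eq\<close>. In particular the initial values determine the solution.\<close>

lemma linear_solution_span:
  assumes u: "linear_solution t0 R 1 0 u" and v: "linear_solution t0 R 0 1 v"
    and y: "linear_solution t0 R a b y"
    and t: "t0 \<in> unit_disc" "t \<in> unit_disc"
  shows "y t = a * u t + b * v t"
proof -
  have "u t * deriv v t - deriv u t * v t = 1" "y t * deriv v t - deriv y t * v t = a"
    "u t * deriv y t - deriv u t * y t = b"
    using wronskian_eq[OF u v t] wronskian_eq[OF y v t] wronskian_eq[OF u y t] by simp_all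
  note W = this
  have "y t = y t * (u t * deriv v t - deriv u t * v t)"
    using W(1) by simp
  also have "\<dots> = (y t * deriv v t - deriv y t * v t) * u t + (u t * deriv y t - deriv u t * y t) * v t"
    by (simp add: algebra_simps)
  finally show ?thesis
    using W(2,3) by simp
qed

text \<open>\<open>Y\<^sub>h Y\<^sub>0\<inverse>\<close>, where \<open>det Y\<^sub>0 = -1\<close> by the normalization of \<open>u\<close> and \<open>v\<close>.\<close>

definition transition ::
  "(complex \<Rightarrow> complex) \<Rightarrow> (complex \<Rightarrow> complex) \<Rightarrow> (complex \<Rightarrow> complex) \<Rightarrow> (complex \<Rightarrow> complex)
    \<Rightarrow> complex \<Rightarrow> complex ^ 2 ^ 2" where
  "transition u v u0 v0 t = vector
     [vector [deriv v t * u0 t - v t * deriv u0 t, v t * deriv v0 t - deriv v t * v0 t],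
      vector [deriv u t * u0 t - u t * deriv u0 t, u t * deriv v0 t - deriv u t * v0 t]]"

text \<open>The row \<open>(y, y')\<close> is multiplied by the inverse of the matrix with rows
  \<open>(c, d)\<close> and \<open>(a, b)\<close>, of determinant -1, and then by that matrix. In
  the uses below \<open>a, b, c, d\<close> are \<open>u0\<close> and its derivative, then
  \<open>v0\<close> and its derivative.\<close>

lemma unimodular_solve:
  fixes a b c d y y' :: "'a::comm_ring_1"
  assumes "a * d - b * c = 1"
  shows "(y' * a - y * b) * c + (y * d - y' * c) * a = y"
    and "(y' * a - y * b) * d + (y * d - y' * c) * b = y'"
proof -
  have "(y' * a - y * b) * c + (y * d - y' * c) * a = y * (a * d - b * c)"
    "(y' * a - y * b) * d + (y * d - y' * c) * b = y' * (a * d - b * c)"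
    by (simp_all add: algebra_simps)
  then show "(y' * a - y * b) * c + (y * d - y' * c) * a = y"
    and "(y' * a - y * b) * d + (y * d - y' * c) * b = y'"
    using assms by simp_all
qed

lemma transition_mult:
  assumes "u0 t * deriv v0 t - deriv u0 t * v0 t = 1"
  shows "transition u v u0 v0 t ** vector [vector [v0 t, deriv v0 t], vector [u0 t, deriv u0 t]]
    = (vector [vector [v t, deriv v t], vector [u t, deriv u t]] :: complex ^ 2 ^ 2)"
  unfolding vec_eq_iff forall_2
  by (simp add: transition_def matrix_matrix_mult_def sum_2 unimodular_solve[OF assms])

lemma kernel_matrix_nth:
  "kernel_matrix u v q s $ 1 $ 1 = - (q s * u s * v s)"
  "kernel_matrix u v q s $ 1 $ 2 = q s * (v s)\<^sup>2"
  "kernel_matrix u v q s $ 2 $ 1 = - (q s * (u s)\<^sup>2)"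
  "kernel_matrix u v q s $ 2 $ 2 = q s * u s * v s"
  by (simp_all add: kernel_matrix_def map_matrix_def)

text \<open>Each entry is, up to sign, a mixed Wronskian of a solution for \<open>R + Q\<close> and
  one for \<open>R\<close>. In its derivative \<open>R\<close> cancels and \<open>Q\<close> times
  the product of the two solutions remains. Expanding the perturbed solution in \<open>u0\<close>
  and \<open>v0\<close>, with entries of \<open>transition\<close> as coefficients, produces the
  matrix product.\<close>

lemma transition_derivative:
  assumes u: "linear_solution t0 (\<lambda>s. R s + Q s) 1 0 u" and v: "linear_solution t0 (\<lambda>s. R s + Q s) 0 1 v"
    and u0: "linear_solution t0 R 1 0 u0" and v0: "linear_solution t0 R 0 1 v0"
    and t: "t0 \<in> unit_disc" "t \<in> unit_disc"
  shows "((\<lambda>t. transition u v u0 v0 t $ i $ j) has_field_derivative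
           (transition u v u0 v0 t ** kernel_matrix u0 v0 Q t) $ i $ j) (at t)"
proof -
  note D = linear_solution_derivs[OF u t(2)] linear_solution_derivs[OF v t(2)]
    linear_solution_derivs[OF u0 t(2)] linear_solution_derivs[OF v0 t(2)]
  have W: "u0 t * deriv v0 t - deriv u0 t * v0 t = 1"
    using wronskian_eq[OF u0 v0 t] by simp
  have D1: "((\<lambda>t. deriv y t * u0 t - y t * deriv u0 t) has_field_derivative - (Q t * y t * u0 t)) (at t)"
    and D2: "((\<lambda>t. y t * deriv v0 t - deriv y t * v0 t) has_field_derivative Q t * y t * v0 t) (at t)"
    if "y = u \<or> y = v" for y
  proof -
    have Y: "(y has_field_derivative deriv y t) (at t)"
      "(deriv y has_field_derivative - ((R t + Q t) * y t)) (at t)"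
      using that D by auto
    show "((\<lambda>t. deriv y t * u0 t - y t * deriv u0 t) has_field_derivative - (Q t * y t * u0 t)) (at t)"
      by (rule derivative_eq_intros D Y refl)+ (simp add: algebra_simps)
    show "((\<lambda>t. y t * deriv v0 t - deriv y t * v0 t) has_field_derivative Q t * y t * v0 t) (at t)"
      by (rule derivative_eq_intros D Y refl)+ (simp add: algebra_simps)
  qed
  note solve = unimodular_solve(1)[OF W]
  have
    "- (Q t * y t * u0 t) = - ((deriv y t * u0 t - y t * deriv u0 t) * (Q t * u0 t * v0 t))
        - (y t * deriv v0 t - deriv y t * v0 t) * (Q t * (u0 t)\<^sup>2)"
    "Q t * y t * v0 t = (deriv y t * u0 t - y t * deriv u0 t) * (Q t * (v0 t)\<^sup>2)
        + (y t * deriv v0 t - deriv y t * v0 t) * (Q t * u0 t * v0 t)" for y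
    \<comment> \<open>Only the first \<open>y t\<close>, the one on the left-hand side, is expanded
      in \<open>u0\<close> and \<open>v0\<close>; those inside the coefficients stay.\<close>
    by (subst (1) solve[of "deriv y t" "y t", symmetric], simp add: algebra_simps power2_eq_square)+
  note D12 = DERIV_cong[OF D1 this(1)] DERIV_cong[OF D2 this(2)]
  show ?thesis
    using exhaust_2[of i] exhaust_2[of j]
    by (auto simp: transition_def matrix_matrix_mult_def sum_2 kernel_matrix_nth
        intro!: D12)
qed

lemma transition_at_base:
  assumes "linear_solution t0 R 1 0 u" "linear_solution t0 R 0 1 v"
    and "linear_solution t0 R0 1 0 u0" "linear_solution t0 R0 0 1 v0"
  shows "transition u v u0 v0 t0 = mat 1"
  using assms unfolding vec_eq_iff forall_2
  by (simp add: linear_solution_def transition_def mat_def)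

section \<open>The Picard series\<close>

lemma sums_of_remainders:
  fixes H :: "nat \<Rightarrow> 'a::real_normed_vector"
  assumes "(\<lambda>n. x - (\<Sum>m<n. H m)) \<longlonglongrightarrow> 0"
  shows "H sums x"
proof -
  have "(\<lambda>n. x - (x - (\<Sum>m<n. H m))) \<longlonglongrightarrow> x - 0"
    by (intro tendsto_intros assms)
  then show ?thesis
    by (simp add: sums_def)
qed

lemma has_vector_derivative_linepath_compose:
  assumes "(f has_field_derivative f') (at (linepath a b s))"
  shows "((\<lambda>s. f (linepath a b s)) has_vector_derivative (b - a) * f') (at s)"
proof -
  have "(linepath a b has_vector_derivative (b - a)) (at s)"
    by (rule has_vector_derivative_linepath_within)
  from field_vector_diff_chain_at[OF this assms] show ?thesis
    by (simp add: o_def)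
qed

text \<open>The remainder of the Picard iteration after \<open>n\<close> terms is the \<open>n\<close>-fold iterated integral
  of a bounded function, whence the factorial in its bound.\<close>

lemma picard_iterates_sums:
  fixes N K :: "complex \<Rightarrow> complex ^ 'n ^ 'n" and H :: "nat \<Rightarrow> complex \<Rightarrow> complex ^ 'n ^ 'n"
  assumes S: "convex S" "t0 \<in> S" "T \<in> S"
    and K: "\<And>i j. continuous_on S (\<lambda>t. K t $ i $ j)"
    and N: "\<And>t i j. t \<in> S \<Longrightarrow> ((\<lambda>t. N t $ i $ j) has_field_derivative (N t ** K t) $ i $ j) (at t)"
    and N0: "N t0 = mat 1"
    and H1: "\<And>t i j. t \<in> S \<Longrightarrow> ((\<lambda>t. H 0 t $ i $ j) has_field_derivative K t $ i $ j) (at t)"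
    and H2: "\<And>n t i j. t \<in> S \<Longrightarrow>
      ((\<lambda>t. H (Suc n) t $ i $ j) has_field_derivative (H n t ** K t) $ i $ j) (at t)"
    and H0: "\<And>n. H n t0 = 0"
  shows "(\<lambda>n. H n T) sums (N T - mat 1)"
proof -
  \<comment> \<open>The identity is the initial Picard iterate and is not among the
    \<open>H m\<close>, so \<open>E 0\<close> is \<open>N - mat 1\<close> rather than
    \<open>N\<close>.\<close>
  define E where "E n t = N t - mat 1 - (\<Sum>m<n. H m t)" for n t
  have E0: "E n t0 = 0" for n
    by (simp add: E_def N0 H0)
  have E_Suc: "E (Suc n) t = E n t - H n t" for n t
    by (simp add: E_def algebra_simps)
  have dE0: "((\<lambda>t. E 0 t $ i $ j) has_field_derivative (N t ** K t) $ i $ j) (at t)"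
    if "t \<in> S" for t i j
    unfolding E_def by (rule derivative_eq_intros refl N that | simp)+
  \<comment> \<open>The remainders obey the same recursion as the \<open>H n\<close>; together with
    \<open>E0\<close> this makes each one the integral of its predecessor times
    \<open>K\<close>.\<close>
  have dE: "((\<lambda>t. E (Suc n) t $ i $ j) has_field_derivative (E n t ** K t) $ i $ j) (at t)"
    if t: "t \<in> S" for n t i j
  proof (induction n)
    case 0
    have "((\<lambda>t. E 0 t $ i $ j - H 0 t $ i $ j) has_field_derivative
             (N t ** K t) $ i $ j - K t $ i $ j) (at t)"
      by (intro DERIV_diff dE0 H1 t)
    moreover have "(N t ** K t) $ i $ j - K t $ i $ j = (E 0 t ** K t) $ i $ j"
      by (simp add: E_def matrix_matrix_mult_def mat_def left_diff_distrib sum_subtractf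
          if_distrib[of "\<lambda>x. x * _"] cong: if_cong)
    ultimately show ?case
      by (simp add: E_Suc)
  next
    case (Suc n)
    have "((\<lambda>t. E (Suc n) t $ i $ j - H (Suc n) t $ i $ j) has_field_derivative
             (E n t ** K t) $ i $ j - (H n t ** K t) $ i $ j) (at t)"
      by (intro DERIV_diff Suc H2 t)
    moreover have "(E n t ** K t) $ i $ j - (H n t ** K t) $ i $ j = (E (Suc n) t ** K t) $ i $ j"
      by (simp add: E_Suc matrix_matrix_mult_def left_diff_distrib sum_subtractf)
    ultimately show ?case
      by (simp add: E_Suc[of "Suc n"])
  qed
  define \<gamma> where "\<gamma> = linepath t0 T"
  have \<gamma>: "\<gamma> s \<in> S" if "s \<in> {0..1}" for s
    using S that convex_contains_segment[of S] linepath_in_path[of s t0 T]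
    unfolding \<gamma>_def by blast
  have comp: "compact (\<gamma> ` {0..1})"
    by (auto simp: \<gamma>_def intro!: compact_continuous_image continuous_on_linepath)
  have \<gamma>S: "\<gamma> ` {0..1} \<subseteq> S"
    using \<gamma> by blast
  have bounded: "\<exists>B\<ge>0. \<forall>i j. \<forall>s\<in>{0..1}. cmod (X (\<gamma> s) $ i $ j) \<le> B"
    if "\<And>i j. continuous_on S (\<lambda>t. X t $ i $ j)" for X :: "complex \<Rightarrow> complex ^ 'n ^ 'n"
  proof -
    have "\<forall>i j. \<exists>B. \<forall>s\<in>{0..1}. cmod (X (\<gamma> s) $ i $ j) \<le> B"
    proof (intro allI)
      fix i j
      have "bounded ((\<lambda>t. X t $ i $ j) ` (\<gamma> ` {0..1}))"
        by (intro compact_imp_bounded compact_continuous_image comp continuous_on_subset[OF that \<gamma>S])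
      then show "\<exists>B. \<forall>s\<in>{0..1}. cmod (X (\<gamma> s) $ i $ j) \<le> B"
        by (auto simp: bounded_iff)
    qed
    then obtain B where B: "\<And>i j s. s \<in> {0..1} \<Longrightarrow> cmod (X (\<gamma> s) $ i $ j) \<le> B i j"
      by metis
    have pos: "0 \<le> B i j" for i j
      using norm_ge_zero B[of 0 i j] by (meson atLeastAtMost_iff order_refl order_trans zero_le_one)
    have "B i j \<le> (\<Sum>i\<in>UNIV. \<Sum>j\<in>UNIV. B i j)" for i j
    proof -
      have "B i j \<le> (\<Sum>j\<in>UNIV. B i j)"
        by (rule member_le_sum) (auto simp: pos)
      also have "\<dots> \<le> (\<Sum>i\<in>UNIV. \<Sum>j\<in>UNIV. B i j)"
        by (rule member_le_sum) (auto simp: pos sum_nonneg)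
      finally show ?thesis .
    qed
    then have "\<forall>i j. \<forall>s\<in>{0..1}. cmod (X (\<gamma> s) $ i $ j) \<le> (\<Sum>i\<in>UNIV. \<Sum>j\<in>UNIV. B i j)"
      using B order_trans by blast
    moreover have "0 \<le> (\<Sum>i\<in>UNIV. \<Sum>j\<in>UNIV. B i j)"
      by (intro sum_nonneg pos)
    ultimately show ?thesis
      by blast
  qed
  obtain k where k: "k \<ge> 0" "\<And>i j s. s \<in> {0..1} \<Longrightarrow> cmod (K (\<gamma> s) $ i $ j) \<le> k"
    using bounded[OF K] by metis
  have "continuous_on S (\<lambda>t. E 0 t $ i $ j)" for i j
    using dE0 by (meson DERIV_isCont continuous_at_imp_continuous_on)
  from bounded[OF this] obtain C where C: "C \<ge> 0"
      "\<And>i j s. s \<in> {0..1} \<Longrightarrow> cmod (E 0 (\<gamma> s) $ i $ j) \<le> C"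
    by metis
  \<comment> \<open>The three factors account for the number of terms in an entry of a matrix
    product, the bound on \<open>K\<close>, and the speed of the segment from \<open>t0\<close> to
    \<open>T\<close>.\<close>
  define c where "c = real CARD('n) * k * cmod (T - t0)"
  have bound: "cmod (E n (\<gamma> s) $ i $ j) \<le> C * (c * s) ^ n / fact n" if "s \<in> {0..1}" for n s i j
    using that
  proof (induction n arbitrary: s i j)
    case 0
    then show ?case using C by simp
  next
    case (Suc n)
    show ?case
    proof (cases "s = 0")
      case True
      then show ?thesis by (simp add: \<gamma>_def linepath_0' E0)
    next
      case False
      let ?f = "\<lambda>s. E (Suc n) (\<gamma> s) $ i $ j"
      let ?\<phi> = "\<lambda>s. C * (c * s) ^ Suc n / fact (Suc n)"
      have df: "(?f has_vector_derivative (T - t0) * (E n (\<gamma> x) ** K (\<gamma> x)) $ i $ j) (at x)"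
        if "x \<in> {0..1}" for x
        unfolding \<gamma>_def
        by (rule has_vector_derivative_linepath_compose[OF dE])
           (use \<gamma>[OF that] in \<open>simp add: \<gamma>_def\<close>)
      have "cmod (?f s - ?f 0) \<le> ?\<phi> s - ?\<phi> 0"
      proof (rule differentiable_bound_general)
        show "0 < s" using Suc.prems False by auto
        show "continuous_on {0..s} ?f"
          using Suc.prems
          by (intro continuous_at_imp_continuous_on ballI has_vector_derivative_continuous[OF df]) auto
        show "continuous_on {0..s} ?\<phi>"
          by (intro continuous_intros) auto
        show "(?\<phi> has_vector_derivative C * c * (c * x) ^ n / fact n) (at x)" for x
          unfolding has_real_derivative_iff_has_vector_derivative[symmetric]
          by (rule derivative_eq_intros refl)+
             (simp_all add: fact_Suc divide_simps del: of_nat_Suc)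
        fix x assume x: "0 < x" "x < s"
        then have x1: "x \<in> {0..1}" using Suc.prems by auto
        show "(?f has_vector_derivative (T - t0) * (E n (\<gamma> x) ** K (\<gamma> x)) $ i $ j) (at x)"
          by (rule df[OF x1])
        have "cmod ((E n (\<gamma> x) ** K (\<gamma> x)) $ i $ j)
            \<le> (\<Sum>l\<in>UNIV. cmod (E n (\<gamma> x) $ i $ l * K (\<gamma> x) $ l $ j))"
          by (simp add: matrix_matrix_mult_def norm_sum)
        also have "\<dots> \<le> (\<Sum>l\<in>(UNIV :: 'n set). C * (c * x) ^ n / fact n * k)"
        proof (rule sum_mono)
          fix l
          show "cmod (E n (\<gamma> x) $ i $ l * K (\<gamma> x) $ l $ j) \<le> C * (c * x) ^ n / fact n * k"
            unfolding norm_mult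
            using Suc.IH[OF x1, of i l] k(2)[OF x1, of l j] 
            by (intro mult_mono) (auto intro: order_trans[OF norm_ge_zero])
        qed
        finally have "cmod ((E n (\<gamma> x) ** K (\<gamma> x)) $ i $ j)
            \<le> real CARD('n) * (C * (c * x) ^ n / fact n * k)"
          by simp
        from mult_left_mono[OF this, of "cmod (T - t0)"]
        show "cmod ((T - t0) * (E n (\<gamma> x) ** K (\<gamma> x)) $ i $ j) \<le> C * c * (c * x) ^ n / fact n"
          by (simp add: norm_mult c_def mult_ac)
      qed
      then show ?thesis
        by (simp add: \<gamma>_def linepath_0' E0)
    qed
  qed
  have "(\<lambda>n. E n T) \<longlonglongrightarrow> 0"
  proof (intro vec_tendstoI)
    fix i j
    \<comment> \<open>At \<open>s = 1\<close> the bound is a constant times a term of the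
      exponential series.\<close>
    have "(\<lambda>n. C * (c ^ n / fact n)) \<longlonglongrightarrow> C * 0"
      using summable_LIMSEQ_zero[OF summable_exp[of c]] by (intro tendsto_mult_left) (simp add: divide_inverse mult.commute)
    then have "(\<lambda>n. C * (c ^ n / fact n)) \<longlonglongrightarrow> 0"
      by simp
    moreover have "cmod (E n T $ i $ j) \<le> C * (c ^ n / fact n)" for n
      using bound[of 1 n i j] by (simp add: \<gamma>_def linepath_1')
    ultimately show "(\<lambda>n. E n T $ i $ j) \<longlonglongrightarrow> 0 $ i $ j"
      by (simp add: Lim_null_comparison[of "\<lambda>n. E n T $ i $ j" "\<lambda>n. C * (c ^ n / fact n)"])
  qed
  then show ?thesis
    by (intro sums_of_remainders) (simp add: E_def)
qed

section \<open>The homogeneous parts\<close>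

text \<open>On the convex disc the entry has a primitive \<open>G\<close>, and the integral along
  the segment from \<open>t0\<close> to \<open>x\<close> is \<open>G x - G t0\<close>.\<close>

lemma disc_integral_derivative:
  assumes hol: "(\<lambda>s. f s $ i $ j) holomorphic_on unit_disc"
    and t: "t0 \<in> unit_disc" "t \<in> unit_disc"
  shows "((\<lambda>t. disc_integral t0 t f $ i $ j) has_field_derivative f t $ i $ j) (at t)"
proof -
  obtain G where G: "\<And>x. x \<in> unit_disc \<Longrightarrow>
      (G has_field_derivative f x $ i $ j) (at x within unit_disc)"
    using holomorphic_convex_primitive'[OF convex_ball open_ball hol] by auto
  have eq: "G x - G t0 = disc_integral t0 x f $ i $ j" if "x \<in> unit_disc" for x
  proof -
    have "closed_segment t0 x \<subseteq> unit_disc"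
      using that t by (intro closed_segment_subset) auto
    then show ?thesis
      using contour_integral_primitive[OF G, of "linepath t0 x"]
      by (simp add: disc_integral_def contour_integral_unique)
  qed
  have "((\<lambda>x. G x - G t0) has_field_derivative f t $ i $ j) (at t)"
    using G[OF t(2)] t(2) by (auto intro!: derivative_eq_intros simp: at_within_open[OF t(2) open_ball])
  then show ?thesis
    by (rule has_field_derivative_transform_within_open[OF _ open_ball t(2) eq])
qed

lemma disc_integral_refl [simp]: "disc_integral t0 t0 f = 0"
  by (simp add: disc_integral_def vec_eq_iff)

lemma holomorphic_on_disc_integral:
  assumes "(\<lambda>s. f s $ i $ j) holomorphic_on unit_disc" "t0 \<in> unit_disc"
  shows "(\<lambda>t. disc_integral t0 t f $ i $ j) holomorphic_on unit_disc"
  unfolding holomorphic_on_open[OF open_ball] using disc_integral_derivative[OF assms] by blast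

lemma kernel_matrix_holomorphic:
  assumes "u holomorphic_on S" "v holomorphic_on S" "q holomorphic_on S"
  shows "(\<lambda>s. kernel_matrix u v q s $ i $ j) holomorphic_on S"
  using exhaust_2[of i] exhaust_2[of j]
  by (auto simp: kernel_matrix_nth intro!: holomorphic_intros assms)

context
  fixes t0 :: complex and u v :: "complex \<Rightarrow> complex" and q :: "'d::finite \<Rightarrow> complex \<Rightarrow> complex"
  assumes t0: "t0 \<in> unit_disc"
    and hol: "u holomorphic_on unit_disc" "v holomorphic_on unit_disc"
      "\<And>j. q j holomorphic_on unit_disc"
begin

no_notation fps_nth (infixl "$" 75)


text \<open>Holomorphy at one stage gives the integrand of the next stage a primitive, which is what
  makes the iterated integrals differentiable.\<close>

lemma iterated_holomorphic: "(\<lambda>t. iterated t0 u v q n k t $ a $ b) holomorphic_on unit_disc"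
proof (induction n arbitrary: k a b)
  case 0
  show ?case
    by (auto intro!: holomorphic_intros holomorphic_on_disc_integral kernel_matrix_holomorphic hol t0)
next
  case (Suc n)
  have "(\<lambda>s. (\<Sum>j | k j \<noteq> 0. iterated t0 u v q n (k(j := k j - 1)) s ** kernel_matrix u v (q j) s) $ a $ b)
     holomorphic_on unit_disc"
    by (auto simp: matrix_matrix_mult_def
        intro!: holomorphic_intros Suc kernel_matrix_holomorphic hol)
  then show ?case
    by (auto intro!: holomorphic_on_disc_integral t0)
qed

lemma iterated_derivative:
  assumes "t \<in> unit_disc"
  shows "((\<lambda>t. iterated t0 u v q (Suc n) k t $ a $ b) has_field_derivative
      (\<Sum>j | k j \<noteq> 0. (iterated t0 u v q n (k(j := k j - 1)) t ** kernel_matrix u v (q j) t) $ a $ b))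
      (at t)"
proof -
  have "(\<lambda>s. (\<Sum>j | k j \<noteq> 0. iterated t0 u v q n (k(j := k j - 1)) s ** kernel_matrix u v (q j) s) $ a $ b)
     holomorphic_on unit_disc"
    by (auto simp: matrix_matrix_mult_def
        intro!: holomorphic_intros iterated_holomorphic kernel_matrix_holomorphic hol)
  from disc_integral_derivative[OF this t0 assms] show ?thesis
    by simp
qed

lemma iterated_derivative_0:
  assumes "t \<in> unit_disc"
  shows "((\<lambda>t. iterated t0 u v q 0 k t $ a $ b) has_field_derivative
      (\<Sum>j | k = unit_index j. kernel_matrix u v (q j) t $ a $ b)) (at t)"
  by (auto intro!: derivative_intros disc_integral_derivative kernel_matrix_holomorphic hol t0 assms)

end

lemma iterated_base: "iterated t0 u v q n k t0 = 0"
  by (cases n) simp_all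

lemma homogeneous_part_base: "homogeneous_part t0 u v q h t0 n = 0"
  by (simp add: homogeneous_part_def iterated_base map_matrix_def vec_eq_iff)

section \<open>Sums over multi-indices of fixed size\<close>

lemma finite_index_size: "finite {k :: 'd::finite \<Rightarrow> nat. index_size k = n}"
proof (rule finite_subset)
  have "k j \<le> index_size k" for k :: "'d \<Rightarrow> nat" and j
    unfolding index_size_def by (rule member_le_sum) auto
  then show "{k :: 'd \<Rightarrow> nat. index_size k = n} \<subseteq> PiE UNIV (\<lambda>_. {..n})"
    by auto
  show "finite (PiE UNIV (\<lambda>_. {..n}) :: ('d \<Rightarrow> nat) set)"
    by (intro finite_PiE) auto
qed

text \<open>The passage from \<open>k\<close> to \<open>k + e_j\<close> avoids truncated
  subtraction; when \<open>k j \<noteq> 0\<close>, the rule is applied to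
  \<open>k(j := k j - 1)\<close>.\<close>

lemma index_size_Suc: "index_size (k(j := Suc (k j))) = Suc (index_size k)"
  unfolding index_size_def by (subst (1 2) sum.remove[of _ j]) (auto intro!: sum.cong)

lemma index_power_Suc: "index_power h (k(j := Suc (k j))) = index_power h k * h $ j"
  unfolding index_power_def by (subst (1 2) prod.remove[of _ j]) (auto intro!: prod.cong)

lemma index_size_unit: "index_size (unit_index j) = 1"
  by (simp add: index_size_def unit_index_def)

lemma index_power_unit: "index_power h (unit_index j) = h $ j"
proof -
  have "index_power h (unit_index j) = (\<Prod>i\<in>UNIV. if i = j then h $ j else 1)"
    unfolding index_power_def unit_index_def by (rule prod.cong) auto
  then show ?thesis
    by simp
qed

text \<open>The pairs \<open>(k, j)\<close> with \<open>k\<close> of size \<open>n + 1\<close> and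
  \<open>k j \<noteq> 0\<close> correspond to all pairs with \<open>k\<close> of size
  \<open>n\<close>, by subtracting \<open>e_j\<close>; one factor \<open>h $ j\<close> splits off
  the power. This turns the recursion for single coefficients into one for homogeneous
  parts.\<close>

lemma sum_index_shift:
  fixes f :: "('d::finite \<Rightarrow> nat) \<Rightarrow> 'd \<Rightarrow> complex"
  shows "(\<Sum>k | index_size k = Suc n. index_power h k * (\<Sum>j | k j \<noteq> 0. f (k(j := k j - 1)) j))
       = (\<Sum>k | index_size k = n. index_power h k * (\<Sum>j\<in>UNIV. h $ j * f k j))"
proof -
  have "(\<Sum>k | index_size k = Suc n. \<Sum>j | k j \<noteq> 0. index_power h k * f (k(j := k j - 1)) j)
      = (\<Sum>(k, j)\<in>Sigma {k. index_size k = Suc n} (\<lambda>k. {j. k j \<noteq> 0}).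
           index_power h k * f (k(j := k j - 1)) j)"
    by (rule sum.Sigma) (auto simp: finite_index_size)
  also have "\<dots> = (\<Sum>(k, j)\<in>{k. index_size k = n} \<times> UNIV. index_power h k * (h $ j * f k j))"
  proof (rule sum.reindex_bij_witness[of _ "\<lambda>(k, j). (k(j := Suc (k j)), j)"
        "\<lambda>(k, j). (k(j := k j - 1), j)"], goal_cases)
    \<comment> \<open>Case 2 is the size of \<open>k - e_j\<close> and case 5 the equality of the
      summands; both rewrite \<open>k\<close> as \<open>(k - e_j) + e_j\<close>.\<close>
    case (2 x)
    then obtain k j where x: "x = (k, j)" "index_size k = Suc n" "k j \<noteq> 0"
      by auto
    then show ?case
      using index_size_Suc[of "k(j := k j - 1)" j] by simp
  next
    case (5 x)
    then obtain k j where x: "x = (k, j)" "index_size k = Suc n" "k j \<noteq> 0"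
      by auto
    then show ?case
      using index_power_Suc[of h "k(j := k j - 1)" j] by simp
  qed (auto simp: index_size_Suc)
  also have "\<dots> = (\<Sum>k | index_size k = n. \<Sum>j\<in>UNIV. index_power h k * (h $ j * f k j))"
    by (rule sum.Sigma[symmetric]) (auto simp: finite_index_size)
  finally show ?thesis
    by (simp add: sum_distrib_left)
qed

text \<open>The counterpart of \<open>sum_index_shift\<close> in degree one: after exchanging the
  sums, each \<open>j\<close> selects exactly the index \<open>e_j\<close>.\<close>

lemma sum_index_unit:
  fixes f :: "'d::finite \<Rightarrow> complex"
  shows "(\<Sum>k | index_size k = 1. index_power h k * (\<Sum>j | k = unit_index j. f j)) = (\<Sum>j\<in>UNIV. h $ j * f j)"
proof -
  have "(\<Sum>k | index_size k = 1. index_power h k * (\<Sum>j | k = unit_index j. f j))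
      = (\<Sum>k | index_size k = 1. \<Sum>j\<in>UNIV. if k = unit_index j then index_power h k * f j else 0)"
    by (simp add: sum_distrib_left sum.inter_filter[symmetric])
  also have "\<dots> = (\<Sum>j\<in>UNIV. \<Sum>k | index_size k = 1. if k = unit_index j then index_power h k * f j else 0)"
    by (rule sum.swap)
  also have "\<dots> = (\<Sum>j\<in>UNIV. h $ j * f j)"
    by (simp add: finite_index_size index_size_unit index_power_unit)
  finally show ?thesis .
qed

text \<open>Linearity in \<open>q\<close>: the combination of the \<open>M_j\<close> with
  coefficients \<open>h_j\<close> is the kernel of the whole perturbation.\<close>

lemma kernel_matrix_sum:
  "(\<Sum>j\<in>UNIV. c j * kernel_matrix u v (q j) s $ a $ b)
     = kernel_matrix u v (\<lambda>s. \<Sum>j\<in>UNIV. c j * q j s) s $ a $ b"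
  using exhaust_2[of a] exhaust_2[of b]
  by (auto simp: kernel_matrix_nth sum_distrib_left sum_negf mult_ac)

lemma homogeneous_part_nth:
  "homogeneous_part t0 u v q h t n $ a $ b
     = (\<Sum>k | index_size k = n + 1. index_power h k * iterated t0 u v q n k t $ a $ b)"
  by (simp add: homogeneous_part_def map_matrix_def)

context
  fixes t0 :: complex and u v :: "complex \<Rightarrow> complex" and q :: "'d::finite \<Rightarrow> complex \<Rightarrow> complex"
    and h :: "complex ^ 'd"
  assumes t0: "t0 \<in> unit_disc"
    and hol: "u holomorphic_on unit_disc" "v holomorphic_on unit_disc"
      "\<And>j. q j holomorphic_on unit_disc"
begin

no_notation fps_nth (infixl "$" 75)


text \<open>This and the next lemma supply the Picard recursion, with the kernel of the perturbation
  in the role of \<open>K\<close> in \<open>picard_iterates_sums\<close>.\<close>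

lemma homogeneous_part_derivative_0:
  assumes "t \<in> unit_disc"
  shows "((\<lambda>t. homogeneous_part t0 u v q h t 0 $ a $ b) has_field_derivative
      kernel_matrix u v (\<lambda>s. \<Sum>j\<in>UNIV. h $ j * q j s) t $ a $ b) (at t)"
proof -
  have "((\<lambda>t. homogeneous_part t0 u v q h t 0 $ a $ b) has_field_derivative
      (\<Sum>k | index_size k = 1. index_power h k *
         (\<Sum>j | k = unit_index j. kernel_matrix u v (q j) t $ a $ b))) (at t)"
    unfolding homogeneous_part_nth add_0
    by (intro DERIV_sum DERIV_cmult iterated_derivative_0 t0 hol assms)
  then show ?thesis
    by (simp only: sum_index_unit kernel_matrix_sum)
qed

lemma homogeneous_part_derivative_Suc:
  assumes "t \<in> unit_disc"
  shows "((\<lambda>t. homogeneous_part t0 u v q h t (Suc n) $ a $ b) has_field_derivative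
      (homogeneous_part t0 u v q h t n
        ** kernel_matrix u v (\<lambda>s. \<Sum>j\<in>UNIV. h $ j * q j s) t) $ a $ b) (at t)"
proof -
  let ?A = "\<lambda>k. iterated t0 u v q n k t" and ?M = "\<lambda>j. kernel_matrix u v (q j) t"
  have "((\<lambda>t. homogeneous_part t0 u v q h t (Suc n) $ a $ b) has_field_derivative
      (\<Sum>k | index_size k = Suc (Suc n). index_power h k *
         (\<Sum>j | k j \<noteq> 0. (?A (k(j := k j - 1)) ** ?M j) $ a $ b))) (at t)"
    unfolding homogeneous_part_nth Suc_eq_plus1[symmetric]
    by (intro DERIV_sum DERIV_cmult iterated_derivative t0 hol assms)
  also have "(\<Sum>k | index_size k = Suc (Suc n). index_power h k *
         (\<Sum>j | k j \<noteq> 0. (?A (k(j := k j - 1)) ** ?M j) $ a $ b))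
      = (\<Sum>k | index_size k = Suc n. index_power h k * (\<Sum>j\<in>UNIV. h $ j * (?A k ** ?M j) $ a $ b))"
    by (rule sum_index_shift)
  \<comment> \<open>With the inner index \<open>c\<close> of the matrix product summed outside the
    sum over \<open>j\<close>, the factor carrying \<open>k\<close> separates from the factor
    carrying \<open>j\<close>.\<close>
  also have "\<dots> = (\<Sum>k | index_size k = Suc n. \<Sum>c\<in>UNIV.
      index_power h k * ?A k $ a $ c * (\<Sum>j\<in>UNIV. h $ j * ?M j $ c $ b))"
  proof (rule sum.cong[OF refl])
    fix k :: "'d \<Rightarrow> nat"
    have "index_power h k * (\<Sum>j\<in>UNIV. h $ j * (?A k ** ?M j) $ a $ b)
        = (\<Sum>j\<in>UNIV. \<Sum>c\<in>UNIV. index_power h k * ?A k $ a $ c * (h $ j * ?M j $ c $ b))"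
      by (simp add: matrix_matrix_mult_def sum_distrib_left mult_ac)
    also have "\<dots> = (\<Sum>c\<in>UNIV. \<Sum>j\<in>UNIV. index_power h k * ?A k $ a $ c * (h $ j * ?M j $ c $ b))"
      by (rule sum.swap)
    finally show "index_power h k * (\<Sum>j\<in>UNIV. h $ j * (?A k ** ?M j) $ a $ b)
        = (\<Sum>c\<in>UNIV. index_power h k * ?A k $ a $ c * (\<Sum>j\<in>UNIV. h $ j * ?M j $ c $ b))"
      by (simp add: sum_distrib_left)
  qed
  also have "\<dots> = (\<Sum>c\<in>UNIV. \<Sum>k | index_size k = Suc n.
      index_power h k * ?A k $ a $ c * (\<Sum>j\<in>UNIV. h $ j * ?M j $ c $ b))"
    by (rule sum.swap)
  also have "\<dots> = (homogeneous_part t0 u v q h t n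
        ** kernel_matrix u v (\<lambda>s. \<Sum>j\<in>UNIV. h $ j * q j s) t) $ a $ b"
    by (simp add: matrix_matrix_mult_def homogeneous_part_nth kernel_matrix_sum sum_distrib_right)
  finally show ?thesis .
qed

end

section \<open>Disc automorphisms and monodromy\<close>

text \<open>By the Schwarz lemma, applied to the automorphism and its inverse after moving the image
  of \<open>0\<close> back to \<open>0\<close>.\<close>

lemma disc_automorphism_cases:
  assumes hol: "L holomorphic_on unit_disc" and bij: "bij_betw L unit_disc unit_disc"
  obtains \<alpha> w where "cmod \<alpha> = 1" "cmod w < 1"
    "\<And>t. t \<in> unit_disc \<Longrightarrow> L t = (\<alpha> * t + w) / (1 + cnj w * \<alpha> * t)"
proof -
  \<comment> \<open>The Moebius map \<open>f\<close> sends \<open>w\<close> to 0 and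
    \<open>g\<close> is its inverse, so \<open>f\<close> after \<open>L\<close> fixes 0 and has
    inverse \<open>k\<close> after \<open>g\<close>.\<close>
  define w where "w = L 0"
  define f where "f = Moebius_function 0 w"
  define g where "g = Moebius_function 0 (- w)"
  have inj: "inj_on L unit_disc" and im: "L ` unit_disc = unit_disc"
    using bij by (auto simp: bij_betw_def)
  have w: "cmod w < 1"
    using im by (auto simp: w_def)
  have f: "f holomorphic_on unit_disc" "f ` unit_disc \<subseteq> unit_disc"
    and g: "g holomorphic_on unit_disc" "g ` unit_disc \<subseteq> unit_disc"
    using w by (auto simp: f_def g_def Moebius_function_holomorphic Moebius_function_norm_lt_1)
  have gf: "g (f z) = z" if "z \<in> unit_disc" for z
    using that w by (simp add: f_def g_def Moebius_function_compose)
  obtain k where k: "k holomorphic_on L ` unit_disc" "\<And>z. z \<in> unit_disc \<Longrightarrow> k (L z) = z"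
    using holomorphic_has_inverse[OF hol open_ball inj] by metis
  have kim: "k ` unit_disc \<subseteq> unit_disc"
    using k(2) im by (metis image_subsetI imageE)
  have \<phi>hol: "(\<lambda>z. f (L z)) holomorphic_on unit_disc"
    using holomorphic_on_compose_gen[OF hol f(1)] im by (simp add: o_def)
  have \<psi>hol: "(\<lambda>z. k (g z)) holomorphic_on unit_disc"
    using holomorphic_on_compose_gen[OF g(1) k(1)] im g(2) by (simp add: o_def)
  have \<phi>0: "f (L 0) = 0"
    by (simp add: f_def w_def Moebius_function_eq_zero)
  have \<psi>0: "k (g 0) = 0"
    using gf[of w] k(2)[of 0] w \<phi>0 by (simp add: w_def)
  have \<phi>im: "cmod (f (L z)) < 1" if "cmod z < 1" for z
    using f(2) im that by (auto simp: image_subset_iff)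
  have \<psi>im: "cmod (k (g z)) < 1" if "cmod z < 1" for z
    using g(2) kim that by (auto simp: image_subset_iff)
  have half: "cmod (1 / 2 :: complex) < 1"
    by (simp add: norm_divide)
  \<comment> \<open>At the test point 1/2 the Schwarz bounds for the map and for its inverse force
    equality of moduli, so the map is a rotation.\<close>
  have "L (1 / 2) \<in> unit_disc"
    using im half by (metis image_eqI mem_ball_0)
  then have "k (g (f (L (1 / 2)))) = 1 / 2"
    using gf k(2)[of "1 / 2"] half by simp
  then have "cmod (1 / 2 :: complex) \<le> cmod (f (L (1 / 2)))"
    using Schwarz_Lemma(1)[OF \<psi>hol \<psi>0 \<psi>im \<phi>im[OF half]] by (simp only:)
  moreover have "cmod (f (L (1 / 2))) \<le> cmod (1 / 2 :: complex)"
    using Schwarz_Lemma(1)[OF \<phi>hol \<phi>0 \<phi>im half] .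
  ultimately have "cmod (1 / 2 :: complex) < 1 \<and> (1 / 2 :: complex) \<noteq> 0
      \<and> cmod (f (L (1 / 2))) = cmod (1 / 2 :: complex)"
    using half by simp
  then obtain \<alpha> where \<alpha>: "\<And>z. cmod z < 1 \<Longrightarrow> f (L z) = \<alpha> * z" "cmod \<alpha> = 1"
    using Schwarz_Lemma(3)[OF \<phi>hol \<phi>0 \<phi>im half] by blast
  show ?thesis
  proof (rule that[OF \<alpha>(2) w])
    fix t :: complex assume t: "t \<in> unit_disc"
    then have "L t \<in> unit_disc"
      using im by blast
    then have "L t = g (\<alpha> * t)"
      using gf[of "L t"] \<alpha>(1)[of t] t by simp
    then show "L t = (\<alpha> * t + w) / (1 + cnj w * \<alpha> * t)"
      by (simp add: g_def Moebius_function_simple mult.assoc)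
  qed
qed

text \<open>The Moebius form gives \<open>deriv L t\<close> as a nonzero constant \<open>D\<close>
  over the square of the affine denominator. Hence \<open>\<xi>\<close> times that denominator has
  constant square \<open>D\<close>; its derivative vanishes, so it is itself constant, and the
  reciprocal of \<open>\<xi>\<close> is affine.\<close>

lemma disc_automorphism_sqrt_deriv:
  assumes hol: "L holomorphic_on unit_disc" and bij: "bij_betw L unit_disc unit_disc"
    and \<xi>: "\<xi> holomorphic_on unit_disc" "\<And>t. t \<in> unit_disc \<Longrightarrow> (\<xi> t)\<^sup>2 = deriv L t"
  obtains m n where "\<And>t. t \<in> unit_disc \<Longrightarrow> \<xi> t * (m * t + n) = 1"
proof -
  obtain \<alpha> w where \<alpha>: "cmod \<alpha> = 1" and w: "cmod w < 1"
    and L: "\<And>t. t \<in> unit_disc \<Longrightarrow> L t = (\<alpha> * t + w) / (1 + cnj w * \<alpha> * t)"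
    using disc_automorphism_cases[OF hol bij] by metis
  have nz: "1 + cnj w * \<alpha> * t \<noteq> 0" if "t \<in> unit_disc" for t
  proof
    assume "1 + cnj w * \<alpha> * t = 0"
    then have "cmod (cnj w * \<alpha> * t) = 1"
      by (metis add_eq_0_iff norm_minus_cancel norm_one)
    moreover have "cmod w * cmod t < 1"
      using w that mult_strict_mono'[of "cmod w" 1 "cmod t" 1] by simp
    ultimately show False
      using \<alpha> by (simp add: norm_mult)
  qed
  define D where "D = \<alpha> * (1 - w * cnj w)"
  have "w * cnj w \<noteq> 1"
    using w by (metis complex_mod_cnj norm_mult norm_one mult_strict_mono' norm_ge_zero less_irrefl mult_1)
  then have D0: "D \<noteq> 0"
    using \<alpha> by (auto simp: D_def)
  have dL: "deriv L t * (1 + cnj w * \<alpha> * t)\<^sup>2 = D" if t: "t \<in> unit_disc" for t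
  proof -
    have "((\<lambda>t. (\<alpha> * t + w) / (1 + cnj w * \<alpha> * t)) has_field_derivative
        D / (1 + cnj w * \<alpha> * t)\<^sup>2) (at t)"
      by (rule derivative_eq_intros refl nz[OF t])+
         (simp add: D_def power2_eq_square algebra_simps)
    then have "(L has_field_derivative D / (1 + cnj w * \<alpha> * t)\<^sup>2) (at t)"
      by (rule has_field_derivative_transform_within_open[OF _ open_ball t]) (simp add: L)
    then show ?thesis
      using nz[OF t] by (simp add: DERIV_imp_deriv)
  qed
  define c where "c t = \<xi> t * (1 + cnj w * \<alpha> * t)" for t
  have c_hol: "c holomorphic_on unit_disc"
    unfolding c_def by (intro holomorphic_intros \<xi>)
  have c2: "(c t)\<^sup>2 = D" if "t \<in> unit_disc" for t
    using dL[OF that] \<xi>(2)[OF that] by (simp add: c_def power_mult_distrib)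
  have c_nz: "c t \<noteq> 0" if "t \<in> unit_disc" for t
    using c2[OF that] D0 by auto
  have c_const: "c t = c 0" if "t \<in> unit_disc" for t
  proof (rule constant_on_convex[of unit_disc c])
    fix s :: complex assume s: "s \<in> unit_disc"
    have dc: "(c has_field_derivative deriv c s) (at s)"
      using holomorphic_derivI[OF c_hol open_ball s] .
    have "((\<lambda>t. (c t)\<^sup>2) has_field_derivative 2 * c s * deriv c s) (at s)"
      by (rule derivative_eq_intros dc refl)+ simp
    moreover have "((\<lambda>t. (c t)\<^sup>2) has_field_derivative 0) (at s)"
      by (rule has_field_derivative_transform_within_open[OF DERIV_const[of D] open_ball s])
         (simp add: c2)
    ultimately have "2 * c s * deriv c s = 0"
      by (rule DERIV_unique)
    then show "(c has_field_derivative 0) (at s)"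
      using dc c_nz[OF s] by simp
  qed (use that in auto)
  show ?thesis
  proof (rule that[of "cnj w * \<alpha> / c 0" "1 / c 0"])
    fix t :: complex assume t: "t \<in> unit_disc"
    have "\<xi> t * (cnj w * \<alpha> / c 0 * t + 1 / c 0) = c t / c 0"
      by (simp add: c_def[of t] add_divide_distrib algebra_simps)
    then show "\<xi> t * (cnj w * \<alpha> / c 0 * t + 1 / c 0) = 1"
      using c_const[OF t] c_nz[of 0] by simp
  qed
qed

text \<open>Weight \<open>-1/2\<close> covariance of \<open>y'' + R y = 0\<close>; that \<open>1/\<xi>\<close> is affine says that the
  Schwarzian of \<open>L\<close> vanishes.\<close>

lemma linear_solution_pullback:
  assumes y: "linear_solution t0 R a b y" and t0: "t0 \<in> unit_disc"
    and L: "L holomorphic_on unit_disc" "L ` unit_disc \<subseteq> unit_disc"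
    and R: "\<And>t. t \<in> unit_disc \<Longrightarrow> R (L t) * (deriv L t)\<^sup>2 = R t"
    and \<xi>: "\<And>t. t \<in> unit_disc \<Longrightarrow> (\<xi> t)\<^sup>2 = deriv L t"
      "\<And>t. t \<in> unit_disc \<Longrightarrow> \<xi> t * (m * t + n) = 1"
  shows "linear_solution t0 R (y (L t0) * (m * t0 + n)) (deriv y (L t0) * \<xi> t0 + y (L t0) * m)
           (\<lambda>t. y (L t) * (m * t + n))"
proof -
  let ?F = "\<lambda>t. y (L t) * (m * t + n)"
  let ?F' = "\<lambda>t. deriv y (L t) * \<xi> t + y (L t) * m"
  have dL: "(L has_field_derivative (\<xi> t)\<^sup>2) (at t)" and Lt: "L t \<in> unit_disc"
    if "t \<in> unit_disc" for t
    using holomorphic_derivI[OF L(1) open_ball that] \<xi>(1)[OF that] L(2) that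
    by (auto simp: image_subset_iff)
  have dy: "((\<lambda>t. y (L t)) has_field_derivative deriv y (L t) * (\<xi> t)\<^sup>2) (at t)"
    "((\<lambda>t. deriv y (L t)) has_field_derivative - (R (L t) * y (L t)) * (\<xi> t)\<^sup>2) (at t)"
    if "t \<in> unit_disc" for t
    using linear_solution_derivs[OF y Lt[OF that]] dL[OF that] by (blast intro: DERIV_chain2)+
  have dF: "(?F has_field_derivative ?F' t) (at t)" if t: "t \<in> unit_disc" for t
  proof -
    \<comment> \<open>One factor \<open>\<xi>\<close> cancels against the affine factor, so the
      second derivative of \<open>L\<close> never has to be written down.\<close>
    have "(\<xi> t)\<^sup>2 * (m * t + n) = \<xi> t"
      using \<xi>(2)[OF t] by (simp add: power2_eq_square mult.assoc)
    then have eq: "deriv y (L t) * (\<xi> t)\<^sup>2 * (m * t + n) = deriv y (L t) * \<xi> t"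
      by (simp only: mult.assoc)
    show ?thesis
      by (rule dy[OF t] derivative_eq_intros refl)+ (use eq in \<open>simp add: mult_ac\<close>)
  qed
  have d\<xi>: "(\<xi> has_field_derivative - m * (\<xi> t)\<^sup>2) (at t)" if t: "t \<in> unit_disc" for t
  proof -
    have inv: "\<xi> s = inverse (m * s + n)" "m * s + n \<noteq> 0" if "s \<in> unit_disc" for s
      using \<xi>(2)[OF that] by (auto simp: inverse_unique mult.commute)
    have "((\<lambda>s. inverse (m * s + n)) has_field_derivative - m * (inverse (m * t + n))\<^sup>2) (at t)"
      using inv(2)[OF t] by (auto intro!: derivative_eq_intros simp: power2_eq_square)
    then have "(\<xi> has_field_derivative - m * (inverse (m * t + n))\<^sup>2) (at t)"
      by (rule has_field_derivative_transform_within_open[OF _ open_ball t]) (simp add: inv)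
    then show ?thesis
      using inv(1)[OF t] by simp
  qed
  \<comment> \<open>The two terms containing \<open>deriv y (L t)\<close> cancel: one comes from
    differentiating \<open>\<xi>\<close>, the other from the chain rule in
    \<open>y (L t) * m\<close>. The invariance of \<open>R\<close> handles the remaining
    term.\<close>
  have dF': "(?F' has_field_derivative - (R t * ?F t)) (at t)" if t: "t \<in> unit_disc" for t
  proof -
    have "R t = R (L t) * ((\<xi> t)\<^sup>2)\<^sup>2"
      using R[OF t] \<xi>(1)[OF t] by simp
    then have "R t * (y (L t) * (m * t + n)) = R (L t) * y (L t) * (\<xi> t)\<^sup>2 * \<xi> t * (\<xi> t * (m * t + n))"
      by (simp add: power2_eq_square mult_ac)
    then have eq: "R t * (y (L t) * (m * t + n)) = R (L t) * y (L t) * (\<xi> t)\<^sup>2 * \<xi> t"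
      using \<xi>(2)[OF t] by simp
    show ?thesis
      by (rule dy[OF t] d\<xi>[OF t] derivative_eq_intros refl)+ (simp add: eq)
  qed
  have eq: "deriv ?F t = ?F' t" if "t \<in> unit_disc" for t
    using dF[OF that] by (rule DERIV_imp_deriv)
  have "deriv (deriv ?F) t = - (R t * ?F t)" if t: "t \<in> unit_disc" for t
    by (rule DERIV_imp_deriv has_field_derivative_transform_within_open[OF dF'[OF t] open_ball t])+
       (simp add: eq)
  moreover have "?F holomorphic_on unit_disc"
    unfolding holomorphic_on_open[OF open_ball] using dF by blast
  ultimately show ?thesis
    using eq[OF t0] by (simp add: linear_solution_def)
qed

text \<open>Values at \<open>t0\<close> give the coefficients of \<open>u\<close> and derivatives at
  \<open>t0\<close> those of \<open>v\<close>. This settles the uniqueness demanded by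
  \<open>THE\<close> in \<open>monodromy_matrix\<close>.\<close>

lemma solution_pair_coeffs_unique:
  assumes u: "linear_solution t0 R 1 0 u" and v: "linear_solution t0 R 0 1 v"
    and t0: "t0 \<in> unit_disc"
    and eq: "\<And>t. t \<in> unit_disc \<Longrightarrow> a * v t + b * u t = a' * v t + b' * u t"
  shows "a = a'" "b = b'"
proof -
  have base: "u t0 = 1" "deriv u t0 = 0" "v t0 = 0" "deriv v t0 = 1"
    using u v by (auto simp: linear_solution_def)
  show "b = b'"
    using eq[OF t0] base by simp
  have D: "((\<lambda>t. a * v t + b * u t) has_field_derivative a) (at t0)" for a b
    using linear_solution_derivs(1)[OF u t0] linear_solution_derivs(1)[OF v t0] base
    by (auto intro!: derivative_eq_intros)
  have "((\<lambda>t. a * v t + b * u t) has_field_derivative a') (at t0)"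
    by (rule has_field_derivative_transform_within_open[OF D[of a' b'] open_ball t0]) (simp add: eq)
  then show "a = a'"
    using D by (rule DERIV_unique[symmetric])
qed

text \<open>The pullbacks of \<open>v\<close> and \<open>u\<close> solve the same equation, so
  \<open>linear_solution_span\<close> reads off their coefficients from their initial data at
  \<open>t0\<close>. The product form separates the solutions, evaluated at \<open>L t0\<close>,
  from a right-hand factor built only from \<open>t0\<close> and the branch \<open>\<xi>\<close>
  with its affine reciprocal.\<close>

lemma monodromy_matrix_eq:
  assumes u: "linear_solution t0 R 1 0 u" and v: "linear_solution t0 R 0 1 v"
    and t0: "t0 \<in> unit_disc"
    and L: "L holomorphic_on unit_disc" "L ` unit_disc \<subseteq> unit_disc"
    and R: "\<And>t. t \<in> unit_disc \<Longrightarrow> R (L t) * (deriv L t)\<^sup>2 = R t"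
    and \<xi>: "\<And>t. t \<in> unit_disc \<Longrightarrow> (\<xi> t)\<^sup>2 = deriv L t"
      "\<And>t. t \<in> unit_disc \<Longrightarrow> \<xi> t * (m * t + n) = 1"
  defines "M \<equiv> vector [vector [v (L t0), deriv v (L t0)], vector [u (L t0), deriv u (L t0)]]
      ** (vector [vector [m, m * t0 + n], vector [\<xi> t0, 0]] :: complex ^ 2 ^ 2)"
  shows "monodromy_matrix \<xi> u v L = M"
    and "t \<in> unit_disc \<Longrightarrow> v (L t) = \<xi> t * (M $ 1 $ 1 * v t + M $ 1 $ 2 * u t)"
    and "t \<in> unit_disc \<Longrightarrow> u (L t) = \<xi> t * (M $ 2 $ 1 * v t + M $ 2 $ 2 * u t)"
proof -
  have row: "y (L t) = \<xi> t * ((y (L t0) * m + deriv y (L t0) * \<xi> t0) * v t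
      + y (L t0) * (m * t0 + n) * u t)"
    if y: "linear_solution t0 R a b y" and t: "t \<in> unit_disc" for a b y t
  proof -
    have "y (L t) * (m * t + n) = y (L t0) * (m * t0 + n) * u t
        + (deriv y (L t0) * \<xi> t0 + y (L t0) * m) * v t"
      using linear_solution_span[OF u v linear_solution_pullback[OF y t0 L R \<xi>] t0 t] by simp
    moreover have "y (L t) = \<xi> t * (y (L t) * (m * t + n))"
      using \<xi>(2)[OF t] by (simp add: mult.left_commute)
    ultimately show ?thesis
      by (simp add: algebra_simps)
  qed
  have M: "M $ 1 $ 1 = v (L t0) * m + deriv v (L t0) * \<xi> t0" "M $ 1 $ 2 = v (L t0) * (m * t0 + n)"
    "M $ 2 $ 1 = u (L t0) * m + deriv u (L t0) * \<xi> t0" "M $ 2 $ 2 = u (L t0) * (m * t0 + n)"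
    by (simp_all add: M_def matrix_matrix_mult_def sum_2)
  show rows: "v (L t) = \<xi> t * (M $ 1 $ 1 * v t + M $ 1 $ 2 * u t)"
    "u (L t) = \<xi> t * (M $ 2 $ 1 * v t + M $ 2 $ 2 * u t)" if "t \<in> unit_disc" for t
    using row[OF v that] row[OF u that] unfolding M by auto
  have expand: "vector [v (L t), u (L t)] = \<xi> t *s (X *v vector [v t, u t]) \<longleftrightarrow>
      v (L t) = \<xi> t * (X $ 1 $ 1 * v t + X $ 1 $ 2 * u t) \<and>
      u (L t) = \<xi> t * (X $ 2 $ 1 * v t + X $ 2 $ 2 * u t)" for X :: "complex ^ 2 ^ 2" and t
    unfolding vec_eq_iff forall_2 by (simp add: matrix_vector_mult_def sum_2)
  show "monodromy_matrix \<xi> u v L = M"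
    unfolding monodromy_matrix_def
  proof (rule the_equality)
    show "\<forall>t\<in>unit_disc. vector [v (L t), u (L t)] = \<xi> t *s (M *v vector [v t, u t])"
      using rows expand by blast
    fix X :: "complex ^ 2 ^ 2"
    assume X: "\<forall>t\<in>unit_disc. vector [v (L t), u (L t)] = \<xi> t *s (X *v vector [v t, u t])"
    have nz: "\<xi> t \<noteq> 0" if "t \<in> unit_disc" for t
      using \<xi>(2)[OF that] by auto
    have "X $ 1 $ 1 * v t + X $ 1 $ 2 * u t = M $ 1 $ 1 * v t + M $ 1 $ 2 * u t"
      "X $ 2 $ 1 * v t + X $ 2 $ 2 * u t = M $ 2 $ 1 * v t + M $ 2 $ 2 * u t"
      if t: "t \<in> unit_disc" for t
      using X[unfolded expand] rows[OF t] nz[OF t] t by (metis mult_left_cancel)+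
    from solution_pair_coeffs_unique[OF u v t0 this(1)] solution_pair_coeffs_unique[OF u v t0 this(2)]
    show "X = M"
      unfolding vec_eq_iff forall_2 by blast
  qed
qed

section \<open>The normalized Schwarz solution\<close>

lemma bigo_tendsto_0:
  fixes f g :: "complex \<Rightarrow> complex"
  assumes "f \<in> O[F](g)" "(g \<longlongrightarrow> 0) F"
  shows "(f \<longlongrightarrow> 0) F"
proof -
  have "g \<in> o[F](\<lambda>_. 1)"
    using assms(2) by (intro smalloI_tendsto) auto
  then have "f \<in> o[F](\<lambda>_. 1)"
    using assms(1) landau_o.big_small_trans by blast
  from smalloD_tendsto[OF this] show ?thesis
    by simp
qed

lemma tendsto_bigo_power:
  fixes f :: "complex \<Rightarrow> complex"
  assumes "(\<lambda>t. f t - c) \<in> O[at t0](\<lambda>t. (t - t0) ^ Suc n)"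
  shows "f \<midarrow>t0\<rightarrow> c"
proof -
  have "((\<lambda>t. (t - t0) ^ Suc n) \<longlongrightarrow> 0) (at t0)"
    by (auto intro!: tendsto_eq_intros)
  with assms have "((\<lambda>t. f t - c) \<longlongrightarrow> 0) (at t0)"
    by (rule bigo_tendsto_0)
  then show ?thesis
    by (simp add: LIM_zero_iff)
qed

text \<open>The difference quotient is of order \<open>t - t0\<close>. Applied to
  \<open>deriv z\<close>, this extracts the vanishing second derivative from the
  normalization.\<close>

lemma has_field_derivative_0_bigo:
  fixes f :: "complex \<Rightarrow> complex"
  assumes "(\<lambda>t. f t - f t0) \<in> O[at t0](\<lambda>t. (t - t0)\<^sup>2)"
  shows "(f has_field_derivative 0) (at t0)"
proof -
  have "(\<lambda>t. (f t - f t0) / (t - t0)) \<in> O[at t0](\<lambda>t. (t - t0)\<^sup>2 / (t - t0))"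
    by (rule landau_o.big.divide_right[OF _ assms]) (auto simp: eventually_at_filter)
  moreover have "((\<lambda>t. (t - t0)\<^sup>2 / (t - t0)) \<longlongrightarrow> 0) (at t0)"
  proof (rule Lim_transform_eventually)
    show "((\<lambda>t. t - t0) \<longlongrightarrow> 0) (at t0)"
      by (auto intro!: tendsto_eq_intros)
    show "\<forall>\<^sub>F t in at t0. t - t0 = (t - t0)\<^sup>2 / (t - t0)"
      by (auto simp: eventually_at_filter power2_eq_square)
  qed
  ultimately have "((\<lambda>t. (f t - f t0) / (t - t0)) \<longlongrightarrow> 0) (at t0)"
    by (rule bigo_tendsto_0)
  then show ?thesis
    by (simp add: has_field_derivative_iff)
qed

text \<open>The difference \<open>d = p - P\<close> satisfies the linear equation \<open>d' = d (p + P)/2\<close>.\<close>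

lemma riccati_unique:
  fixes p P R :: "complex \<Rightarrow> complex"
  assumes S: "convex S" "open S" "t0 \<in> S" "t \<in> S"
    and p: "\<And>t. t \<in> S \<Longrightarrow> (p has_field_derivative (p t)\<^sup>2 / 2 + R t) (at t)"
    and P: "\<And>t. t \<in> S \<Longrightarrow> (P has_field_derivative (P t)\<^sup>2 / 2 + R t) (at t)"
    and init: "p t0 = P t0"
  shows "p t = P t"
proof -
  \<comment> \<open>A primitive \<open>G\<close> of this function provides the integrating factor
    \<open>exp (- G)\<close>, which makes the difference of the two solutions constant.\<close>
  have "(\<lambda>t. (p t + P t) / 2) holomorphic_on S"
    using p P S by (intro holomorphic_intros) (auto simp: holomorphic_on_open)
  then obtain G where "\<And>x. x \<in> S \<Longrightarrow> (G has_field_derivative (p x + P x) / 2) (at x within S)"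
    using holomorphic_convex_primitive'[OF S(1,2)] by blast
  then have G: "\<And>x. x \<in> S \<Longrightarrow> (G has_field_derivative (p x + P x) / 2) (at x)"
    using S(2) by (metis at_within_open)
  have "(p t - P t) * exp (- G t) = (p t0 - P t0) * exp (- G t0)"
  proof (rule constant_on_convex[of S "\<lambda>t. (p t - P t) * exp (- G t)"])
    fix x assume x: "x \<in> S"
    show "((\<lambda>t. (p t - P t) * exp (- G t)) has_field_derivative 0) (at x)"
      by (rule derivative_eq_intros p P G x refl)+ (simp add: field_simps power2_eq_square)
  qed (use S in auto)
  then show ?thesis
    using init by simp
qed

text \<open>Both \<open>z''/z'\<close> and \<open>-2u'/u\<close> solve the Riccati equation
  \<open>p' = p^2/2 + 2R\<close> and vanish at \<open>t0\<close>, so they agree near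
  \<open>t0\<close>. Then \<open>z' u^2\<close> is constantly 1, and the Wronskian shows that
  \<open>z\<close> and \<open>v/u\<close> have the same derivative. The identity theorem extends
  \<open>z u = v\<close> to all points that are not poles. A zero of \<open>u\<close> there would be
  one of \<open>v\<close> as well, contradicting the Wronskian.\<close>

lemma normalized_schwarz_solution_eq:
  assumes u: "linear_solution t0 R 1 0 u" and v: "linear_solution t0 R 0 1 v"
    and t0: "t0 \<in> unit_disc"
    and z: "normalized_schwarz_solution t0 R z"
    and t: "t \<in> unit_disc" "\<not> is_pole z t"
  shows "u t \<noteq> 0" and "z t = v t / u t"
proof -
  define A where "A = {t \<in> unit_disc. \<not> is_pole z t}"
  have mero: "z nicely_meromorphic_on unit_disc"
    and eqn: "\<And>t. t \<in> A \<Longrightarrow> deriv z t \<noteq> 0" "\<And>t. t \<in> A \<Longrightarrow> schwarzian z t = 2 * R t"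
    and z_bigo: "(\<lambda>t. z t - (t - t0)) \<in> O[at t0](\<lambda>t. (t - t0) ^ 3)"
    and sqrt_bigo: "(\<lambda>t. csqrt (deriv z t) - 1) \<in> O[at t0](\<lambda>t. (t - t0)\<^sup>2)"
    using z by (auto simp: normalized_schwarz_solution_def A_def)
  \<comment> \<open>Poles are isolated, so removing them leaves the open connected set
    \<open>A\<close> on which the identity theorem is applied.\<close>
  have sparse: "{t. is_pole z t} sparse_in unit_disc"
    using mero unfolding nicely_meromorphic_on_def
    by (meson open_ball meromorphic_on_isolated_singularity meromorphic_on_meromorphic_at
        not_islimpt_poles sparse_in_open)
  have A_eq: "A = unit_disc - {t. is_pole z t}"
    by (auto simp: A_def)
  have A: "open A" "connected A" "A \<subseteq> unit_disc"
    using sparse unfolding A_eq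
    by (auto intro!: open_diff_sparse_pts sparse_imp_connected)
  have zhol: "z holomorphic_on A"
    using mero A_def nicely_meromorphic_on_imp_analytic_at
    by (metis (mono_tags, lifting) analytic_imp_holomorphic analytic_on_analytic_at mem_Collect_eq)
  note dz = holomorphic_derivI[OF zhol A(1)]
  note d2z = holomorphic_derivI[OF holomorphic_deriv[OF zhol A(1)] A(1)]
  \<comment> \<open>A finite limit at \<open>t0\<close> excludes a pole there, after which
    continuity gives the value of \<open>z\<close> itself.\<close>
  have "((\<lambda>t. z t - (t - t0) + (t - t0)) \<longlongrightarrow> 0 + 0) (at t0)"
  proof (rule tendsto_add)
    show "((\<lambda>t. z t - (t - t0)) \<longlongrightarrow> 0) (at t0)"
      using z_bigo tendsto_bigo_power[of "\<lambda>t. z t - (t - t0)" 0 t0 2] by (simp add: numeral_3_eq_3)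
    show "((\<lambda>t. t - t0) \<longlongrightarrow> 0) (at t0)"
      by (auto intro!: tendsto_eq_intros)
  qed
  then have z_lim: "z \<midarrow>t0\<rightarrow> 0"
    by simp
  then have t0A: "t0 \<in> A"
    using t0 not_tendsto_and_filterlim_at_infinity[OF _ z_lim]
    by (auto simp: A_def is_pole_def at_neq_bot)
  have z0: "z t0 = 0"
    using LIM_unique[OF z_lim] DERIV_isCont[OF dz[OF t0A]] by (simp add: isCont_def)
  have sqrt_lim: "(\<lambda>t. csqrt (deriv z t)) \<midarrow>t0\<rightarrow> 1"
    using sqrt_bigo tendsto_bigo_power[of _ 1 t0 1] by (simp add: numeral_2_eq_2)
  have "(\<lambda>t. (csqrt (deriv z t))\<^sup>2) \<midarrow>t0\<rightarrow> 1\<^sup>2"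
    by (intro tendsto_intros sqrt_lim)
  then have z'0: "deriv z t0 = 1"
    using LIM_unique DERIV_isCont[OF d2z[OF t0A]] by (force simp: isCont_def)
  \<comment> \<open>\<open>deriv z t - 1\<close> factors as \<open>csqrt (deriv z t) - 1\<close>
    times this bounded function, and so inherits the order 2.\<close>
  have "(\<lambda>t. csqrt (deriv z t) + 1) \<in> O[at t0](\<lambda>_. 1)"
    using tendsto_add[OF sqrt_lim tendsto_const[of 1]] by (intro bigoI_tendsto[of _ _ "1 + 1"]) auto
  from landau_o.big.mult[OF sqrt_bigo this]
  have "(\<lambda>t. deriv z t - deriv z t0) \<in> O[at t0](\<lambda>t. (t - t0)\<^sup>2)"
    by (simp add: z'0 algebra_simps flip: power2_eq_square)
  from DERIV_imp_deriv[OF has_field_derivative_0_bigo[OF this]]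
  have z''0: "deriv (deriv z) t0 = 0" .
  have base: "u t0 = 1" "deriv u t0 = 0" "v t0 = 0" "deriv v t0 = 1"
    using u v by (auto simp: linear_solution_def)
  have hol: "u holomorphic_on unit_disc" "v holomorphic_on unit_disc"
    using u v by (auto simp: linear_solution_def)
  have W: "u s * deriv v s - deriv u s * v s = 1" if "s \<in> unit_disc" for s
    using wronskian_eq[OF u v t0 that] by simp
  \<comment> \<open>The aim is a ball around \<open>t0\<close> without poles of \<open>z\<close> and
    zeros of \<open>u\<close>, where \<open>z\<close> and \<open>v/u\<close> can be
    compared.\<close>
  have "(u \<longlongrightarrow> u t0) (nhds t0)"
    using DERIV_isCont[OF linear_solution_derivs(1)[OF u t0]]
    by (simp only: isCont_def tendsto_at_iff_tendsto_nhds)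
  then have "\<forall>\<^sub>F s in nhds t0. u s \<noteq> 0"
    by (rule tendsto_imp_eventually_ne) (simp add: base)
  moreover have "\<forall>\<^sub>F s in nhds t0. s \<in> A"
    using A(1) t0A by (rule eventually_nhds_in_open)
  ultimately have "\<forall>\<^sub>F s in nhds t0. s \<in> A \<and> u s \<noteq> 0"
    by eventually_elim auto
  then obtain e where e: "e > 0" "\<And>s. s \<in> ball t0 e \<Longrightarrow> s \<in> A \<and> u s \<noteq> 0"
    by (auto simp: eventually_nhds_metric dist_commute)
  have sA: "s \<in> A" and sU: "s \<in> unit_disc" and u0: "u s \<noteq> 0" if "s \<in> ball t0 e" for s
    using e(2)[OF that] A(3) by auto
  note du = linear_solution_derivs[OF u sU]
  note dv = linear_solution_derivs[OF v sU]
  have log_deriv: "deriv (deriv z) s / deriv z s = - 2 * deriv u s / u s" if s: "s \<in> ball t0 e" for s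
  proof (rule riccati_unique[of "ball t0 e" t0 s "\<lambda>s. deriv (deriv z) s / deriv z s" "\<lambda>s. 2 * R s"
        "\<lambda>s. - 2 * deriv u s / u s"])
    fix x assume x: "x \<in> ball t0 e"
    have "(\<lambda>s. deriv (deriv z) s / deriv z s) holomorphic_on A"
      using eqn(1) by (intro holomorphic_intros zhol A(1)) auto
    from holomorphic_derivI[OF this A(1) sA[OF x]] eqn(2)[OF sA[OF x]]
    show "((\<lambda>s. deriv (deriv z) s / deriv z s) has_field_derivative
        (deriv (deriv z) x / deriv z x)\<^sup>2 / 2 + 2 * R x) (at x)"
      by (simp add: schwarzian_def algebra_simps)
    show "((\<lambda>s. - 2 * deriv u s / u s) has_field_derivative
        (- 2 * deriv u x / u x)\<^sup>2 / 2 + 2 * R x) (at x)"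
      by (rule derivative_eq_intros du[OF x] refl u0[OF x])+
         (use u0[OF x] in \<open>simp add: field_simps power2_eq_square\<close>)
  qed (use e(1) s base z''0 in auto)
  have z'u2: "deriv z s * (u s)\<^sup>2 = 1" if s: "s \<in> ball t0 e" for s
  proof -
    have "deriv z s * (u s)\<^sup>2 = deriv z t0 * (u t0)\<^sup>2"
    proof (rule constant_on_convex[of "ball t0 e" "\<lambda>s. deriv z s * (u s)\<^sup>2"])
      fix x assume x: "x \<in> ball t0 e"
      have "deriv (deriv z) x * u x = - 2 * deriv u x * deriv z x"
        using log_deriv[OF x] eqn(1)[OF sA[OF x]] u0[OF x] by (simp add: field_simps)
      then have eq: "deriv (deriv z) x * (u x)\<^sup>2 + 2 * u x * deriv u x * deriv z x = 0"
        by (simp add: power2_eq_square flip: mult.assoc)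
      show "((\<lambda>s. deriv z s * (u s)\<^sup>2) has_field_derivative 0) (at x)"
        by (rule du[OF x] d2z[OF sA[OF x]] derivative_eq_intros refl)+
           (use eq in \<open>simp add: mult_ac\<close>)
    qed (use e(1) s in auto)
    then show ?thesis
      by (simp add: z'0 base)
  qed
  have local_eq: "z s * u s - v s = 0" if s: "s \<in> ball t0 e" for s
  proof -
    have "z s - v s / u s = z t0 - v t0 / u t0"
    proof (rule constant_on_convex[of "ball t0 e" "\<lambda>s. z s - v s / u s"])
      fix x assume x: "x \<in> ball t0 e"
      have "deriv z x = 1 / (u x)\<^sup>2"
        using z'u2[OF x] u0[OF x] by (simp add: field_simps)
      also have "\<dots> = (deriv v x * u x - v x * deriv u x) / (u x * u x)"
        using W[OF sU[OF x]] by (simp add: power2_eq_square mult.commute)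
      finally have z': "deriv z x = (deriv v x * u x - v x * deriv u x) / (u x * u x)" .
      show "((\<lambda>s. z s - v s / u s) has_field_derivative 0) (at x)"
        by (rule du[OF x] dv[OF x] dz[OF sA[OF x]] u0[OF x] derivative_eq_intros refl)+ (simp add: z')
    qed (use e(1) s in auto)
    then show ?thesis
      using u0[OF s] by (simp add: z0 base field_simps)
  qed
  \<comment> \<open>The continuation uses the division-free form, because \<open>u\<close> is not
    yet known to be nonzero on all of \<open>A\<close>.\<close>
  have "z t * u t - v t = 0"
  proof (rule analytic_continuation_open[of "ball t0 e" A "\<lambda>t. z t * u t - v t" "\<lambda>_. 0"])
    show "(\<lambda>t. z t * u t - v t) holomorphic_on A"
      by (intro holomorphic_intros zhol holomorphic_on_subset[OF hol(1) A(3)]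
          holomorphic_on_subset[OF hol(2) A(3)])
  qed (use A e(1) sA local_eq t in \<open>auto simp: A_def\<close>)
  then have eq: "v t = z t * u t"
    by simp
  show "u t \<noteq> 0"
    using W[OF t(1)] eq by auto
  then show "z t = v t / u t"
    using eq by simp
qed

section \<open>The expansion of the monodromy\<close>

text \<open>The first conjunct says that \<open>M\<close> acts as the monodromy of
  \<open>z h\<close>; poles are excluded because the value stored there is only a convention.
  Summability is stated separately, since \<open>suminf\<close> carries information only for a
  convergent series. Term \<open>n\<close> of the series has degree \<open>n + 1\<close>.\<close>

theorem theorem3p3:
  fixes F :: "'a::topological_space set"
    and \<A> :: "('a set \<times> ('a \<Rightarrow> complex)) set"
    and p :: "complex \<Rightarrow> 'a"
    and \<Gamma> :: "(complex \<Rightarrow> complex) set"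
    and g :: nat
    and t0 :: complex
    and r :: "complex \<Rightarrow> complex"
    and q :: "'d::finite \<Rightarrow> complex \<Rightarrow> complex"
    and \<xi> :: "(complex \<Rightarrow> complex) \<Rightarrow> complex \<Rightarrow> complex"
    and u v z :: "complex ^ 'd \<Rightarrow> complex \<Rightarrow> complex"
  assumes "riemann_surface F \<A>" and "compact F" and "has_genus F g" and "g \<ge> 2"
    and "disc_universal_covering F \<A> p"
    and "\<Gamma> = covering_transformations p"
    and "t0 \<in> unit_disc"
    and "quadratic_differential \<Gamma> r"
    and "CARD('d) = 3 * g - 3"
    and "quadratic_differential_basis \<Gamma> q"
    and "sqrt_deriv_branches \<Gamma> \<xi>"
    and "\<And>h. linear_solution t0 (perturbed r q h) 1 0 (u h)"
    and "\<And>h. linear_solution t0 (perturbed r q h) 0 1 (v h)"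
    and "\<And>h. normalized_schwarz_solution t0 (perturbed r q h) (z h)"
  shows "\<exists>\<epsilon>>0. \<forall>h. max_norm h < \<epsilon> \<longrightarrow> (\<forall>L\<in>\<Gamma>.
           let M = monodromy_matrix (\<xi> L) (u h) (v h) L;
               M0 = monodromy_matrix (\<xi> L) (u 0) (v 0) L
           in (\<forall>t\<in>unit_disc. \<not> is_pole (z h) t \<and> \<not> is_pole (z h) (L t) \<longrightarrow>
                 z h (L t) = (M $ 1 $ 1 * z h t + M $ 1 $ 2) / (M $ 2 $ 1 * z h t + M $ 2 $ 2)) \<and>
              summable (homogeneous_part t0 (u 0) (v 0) q h (L t0)) \<and>
              M = (mat 1 + suminf (homogeneous_part t0 (u 0) (v 0) q h (L t0))) ** M0)"
proof -
  have t0: "t0 \<in> unit_disc" by fact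
  have u: "\<And>h. linear_solution t0 (perturbed r q h) 1 0 (u h)"
    and v: "\<And>h. linear_solution t0 (perturbed r q h) 0 1 (v h)"
    and z: "\<And>h. normalized_schwarz_solution t0 (perturbed r q h) (z h)"
    by fact+
  have r_inv: "\<And>L t. L \<in> \<Gamma> \<Longrightarrow> t \<in> unit_disc \<Longrightarrow> r (L t) * (deriv L t)\<^sup>2 = r t"
    and q_inv: "\<And>j L t. L \<in> \<Gamma> \<Longrightarrow> t \<in> unit_disc \<Longrightarrow> q j (L t) * (deriv L t)\<^sup>2 = q j t"
    and q_hol: "\<And>j. q j holomorphic_on unit_disc"
    using assms(8,10) by (auto simp: quadratic_differential_def quadratic_differential_basis_def)
  have inv: "perturbed r q h (L t) * (deriv L t)\<^sup>2 = perturbed r q h t"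
    if "L \<in> \<Gamma>" "t \<in> unit_disc" for h L t
    using r_inv[OF that] q_inv[OF that]
    by (simp add: perturbed_def distrib_right sum_distrib_right mult.assoc)
  have unperturbed: "perturbed r q 0 = r"
    by (simp add: perturbed_def fun_eq_iff)
  have u0: "linear_solution t0 r 1 0 (u 0)" and v0: "linear_solution t0 r 0 1 (v 0)"
    using u[of 0] v[of 0] by (simp_all add: unperturbed)
  have hol0: "u 0 holomorphic_on unit_disc" "v 0 holomorphic_on unit_disc"
    using u0 v0 by (auto simp: linear_solution_def)
  \<comment> \<open>The Picard series is applied with potential \<open>r\<close> and perturbation
    \<open>?Q\<close>; its estimate is valid for each \<open>h\<close>, whatever its size.\<close>
  have series: "homogeneous_part t0 (u 0) (v 0) q h T sums (transition (u h) (v h) (u 0) (v 0) T - mat 1)"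
    if T: "T \<in> unit_disc" for h T
  proof -
    let ?Q = "\<lambda>s. \<Sum>j\<in>UNIV. h $ j * q j s"
    have uh: "linear_solution t0 (\<lambda>s. r s + ?Q s) 1 0 (u h)"
      and vh: "linear_solution t0 (\<lambda>s. r s + ?Q s) 0 1 (v h)"
      using u[of h] v[of h] by (simp_all add: perturbed_def[abs_def])
    have "?Q holomorphic_on unit_disc"
      by (intro holomorphic_intros q_hol)
    then have K: "continuous_on unit_disc (\<lambda>s. kernel_matrix (u 0) (v 0) ?Q s $ i $ j)" for i j
      by (intro holomorphic_on_imp_continuous_on kernel_matrix_holomorphic hol0)
    show ?thesis
      by (rule picard_iterates_sums[where H = "\<lambda>n t. homogeneous_part t0 (u 0) (v 0) q h t n",
            OF convex_ball t0 T K
            transition_derivative[OF uh vh u0 v0 t0] transition_at_base[OF uh vh u0 v0]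
            homogeneous_part_derivative_0[OF t0 hol0 q_hol]
            homogeneous_part_derivative_Suc[OF t0 hol0 q_hol]
            homogeneous_part_base])
  qed
  have main: "let M = monodromy_matrix (\<xi> L) (u h) (v h) L;
               M0 = monodromy_matrix (\<xi> L) (u 0) (v 0) L
           in (\<forall>t\<in>unit_disc. \<not> is_pole (z h) t \<and> \<not> is_pole (z h) (L t) \<longrightarrow>
                 z h (L t) = (M $ 1 $ 1 * z h t + M $ 1 $ 2) / (M $ 2 $ 1 * z h t + M $ 2 $ 2)) \<and>
              summable (homogeneous_part t0 (u 0) (v 0) q h (L t0)) \<and>
              M = (mat 1 + suminf (homogeneous_part t0 (u 0) (v 0) q h (L t0))) ** M0"
    if L: "L \<in> \<Gamma>" for h L
  proof -
    have Lhol: "L holomorphic_on unit_disc" and bij: "bij_betw L unit_disc unit_disc"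
      using L assms(6) by (auto simp: covering_transformations_def Bij_def)
    have Lim: "L ` unit_disc \<subseteq> unit_disc"
      using bij by (simp add: bij_betw_def)
    have \<xi>: "\<xi> L holomorphic_on unit_disc" "\<And>t. t \<in> unit_disc \<Longrightarrow> (\<xi> L t)\<^sup>2 = deriv L t"
      using assms(11) L by (auto simp: sqrt_deriv_branches_def)
    obtain m n where mn: "\<And>t. t \<in> unit_disc \<Longrightarrow> \<xi> L t * (m * t + n) = 1"
      using disc_automorphism_sqrt_deriv[OF Lhol bij \<xi>] by metis
    define M where "M h = monodromy_matrix (\<xi> L) (u h) (v h) L" for h
    let ?C = "vector [vector [m, m * t0 + n], vector [\<xi> L t0, 0]] :: complex ^ 2 ^ 2"
    note monodromy = monodromy_matrix_eq[OF u v t0 Lhol Lim inv[OF L] \<xi>(2) mn]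
    have M: "M h = vector [vector [v h (L t0), deriv (v h) (L t0)],
        vector [u h (L t0), deriv (u h) (L t0)]] ** ?C" for h
      unfolding M_def by (rule monodromy(1))
    have rows: "v h (L t) = \<xi> L t * (M h $ 1 $ 1 * v h t + M h $ 1 $ 2 * u h t)"
      "u h (L t) = \<xi> L t * (M h $ 2 $ 1 * v h t + M h $ 2 $ 2 * u h t)" if "t \<in> unit_disc" for t
      unfolding M using monodromy(2,3) that by blast+
    have T: "L t0 \<in> unit_disc"
      using Lim t0 by blast
    note S = series[OF T, of h]
    have "u 0 (L t0) * deriv (v 0) (L t0) - deriv (u 0) (L t0) * v 0 (L t0) = 1"
      using wronskian_eq[OF u0 v0 t0 T] by simp
    \<comment> \<open>The transition matrix turns the left-hand factor of \<open>M 0\<close> into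
      that of \<open>M h\<close>; the right-hand factor \<open>?C\<close> is free of
      \<open>h\<close> and is carried along.\<close>
    then have "transition (u h) (v h) (u 0) (v 0) (L t0) ** M 0 = M h"
      unfolding M matrix_mul_assoc by (simp add: transition_mult)
    then have expansion: "M h = (mat 1 + suminf (homogeneous_part t0 (u 0) (v 0) q h (L t0))) ** M 0"
      by (simp add: sums_unique[OF S, symmetric])
    \<comment> \<open>The branch \<open>\<xi> L t\<close> cancels in the quotient of the two rows;
      dividing numerator and denominator by \<open>u h t\<close>, nonzero off the poles, leaves an
      expression in \<open>z h t\<close>.\<close>
    have moebius: "z h (L t) = (M h $ 1 $ 1 * z h t + M h $ 1 $ 2) / (M h $ 2 $ 1 * z h t + M h $ 2 $ 2)"
      if t: "t \<in> unit_disc" "\<not> is_pole (z h) t" "\<not> is_pole (z h) (L t)" for t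
    proof -
      have Lt: "L t \<in> unit_disc"
        using Lim t by blast
      note zt = normalized_schwarz_solution_eq[OF u v t0 z t(1,2)]
      have "\<xi> L t \<noteq> 0"
        using mn[OF t(1)] by auto
      then have "z h (L t) = (M h $ 1 $ 1 * v h t + M h $ 1 $ 2 * u h t)
          / (M h $ 2 $ 1 * v h t + M h $ 2 $ 2 * u h t)"
        using normalized_schwarz_solution_eq(2)[OF u v t0 z Lt t(3)] rows[OF t(1)] by simp
      also have "\<dots> = (M h $ 1 $ 1 * z h t + M h $ 1 $ 2) / (M h $ 2 $ 1 * z h t + M h $ 2 $ 2)"
      proof -
        have "a * v h t + b * u h t = (a * z h t + b) * u h t" for a b
          using zt by (simp add: field_simps)
        then show ?thesis
          using zt(1) by simp
      qed
      finally show ?thesis .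
    qed
    show ?thesis
      using moebius sums_summable[OF S] expansion unfolding Let_def M_def by blast
  qed
  \<comment> \<open>Since \<open>main\<close> is available for every \<open>h\<close>, the radius 1
    is a convenient choice.\<close>
  show ?thesis
    by (intro exI[of _ "1 :: real"] conjI allI impI ballI main) simp_all
qed

end
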